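(* Let $\alpha>1$. Suppose $\rho_{R\bar CE^N}$ and $\rho_{Z^{\le n}\bar CE^N}$ are states that are classical in $\bar C$ and related as follows: letting $R_{\bar c}$ be a register (subspace of $R$) containing the support of the conditional state $\rho_{R|\bar C=\bar c}$, there exist isometries $V^{(\bar c)}_{R_{\bar c}\to Z^{\le n}}$ such that $$V\rho_{R\bar CE^N}V^\dagger=\rho_{Z^{\le n}\bar CE^N},\qquad\text{where } V:=\sum_{\bar c}V^{(\bar c)}_{R_{\bar c}\to Z^{\le n}}\otimes|\bar c\rangle\langle\bar c|_{\bar C}.$$ Then $$H_\alpha(Z^{\le n}|\bar CE^N)_\rho=H_\alpha(R|\bar CE^N)_\rho .$$
   Context: Finite-dimensional systems; $\log$ is base 2. $Z^{\le n}$ is a register whose computational basis is indexed by bitstrings of length at most $n$; $R$ and $E^N$ are arbitrary registers. $V$ acts as the identity on $E^N$; the expression $V\rho V^\dagger$ is well defined although $V$ is not defined on all of $R\bar C$, because $\rho_{R\bar CE^N}$ is supported only on the subspace where $V$ is defined. Sandwiched Rényi entropy: $H_\alpha(A|B)_\rho:=\max_{\sigma_B}H_\alpha(A|B)_{\rho|\sigma}$, the maximum being over normalized states $\sigma_B$ on $B$, where $H_\alpha(A|B)_{\rho|\sigma}:=\frac1{1-\alpha}\log\mathrm{Tr}\big[\big(\sigma_B^{\frac{1-\alpha}{2\alpha}}\rho_{AB}\sigma_B^{\frac{1-\alpha}{2\alpha}}\big)^\alpha\big]$ if the support of $\rho_{AB}$ is contained in $A\otimes\mathrm{supp}(\sigma_B)$,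 and $-\infty$ otherwise. *)

theory Defs
  imports "HOL-Analysis.Analysis" "HOL-Library.Type_Length"
begin

text \<open>
  A register is a finite type whose elements label its computational basis; its Hilbert space is
  \<open>complex ^ 'a\<close>, and a composite register is a product type. In \<open>A $ i $ j\<close> the first index is
  the row, so \<open>complex ^ 'a ^ 'b\<close> consists of the operators from register \<open>'a\<close> to register \<open>'b\<close>.
\<close>

type_synonym 'a operator = "complex ^ 'a ^ 'a"

text \<open>
  The register with basis labelled by the bitstrings of length at most \<open>n\<close>, where
  \<open>n = LENGTH('n)\<close>. The class \<open>len0\<close> (not \<open>len\<close>) is used so that \<open>n = 0\<close> is included.
\<close>

typedef (overloaded) 'n :: len0 bits_upto = "{w :: bool list. length w \<le> LENGTH('n)}"
  by (rule exI[of _ "[]"]) simp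

instance bits_upto :: (len0) finite
proof
  have "finite {w :: bool list. set w \<subseteq> UNIV \<and> length w \<le> LENGTH('a)}"
    by (rule finite_lists_length_le) simp
  then have "finite (range (Rep_bits_upto :: 'a bits_upto \<Rightarrow> bool list))"
    by (rule rev_finite_subset) (use Rep_bits_upto in auto)
  then show "finite (UNIV :: 'a bits_upto set)"
    by (rule finite_imageD) (simp add: inj_def Rep_bits_upto_inject)
qed

definition cinner :: "complex ^ 'a \<Rightarrow> complex ^ 'a \<Rightarrow> complex" where
  "cinner x y = (\<Sum>i\<in>UNIV. cnj (x $ i) * y $ i)"

definition adjoint_op :: "complex ^ 'a ^ 'b \<Rightarrow> complex ^ 'b ^ 'a" where
  "adjoint_op A = (\<chi> i j. cnj (A $ j $ i))"

definition tensor_vec :: "complex ^ 'a \<Rightarrow> complex ^ 'b \<Rightarrow> complex ^ ('a \<times> 'b)" where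
  "tensor_vec x y = (\<chi> i. x $ fst i * y $ snd i)"

definition tensor_op ::
    "complex ^ 'a ^ 'b \<Rightarrow> complex ^ 'c ^ 'd \<Rightarrow> complex ^ ('a \<times> 'c) ^ ('b \<times> 'd)" where
  "tensor_op A B = (\<chi> i j. A $ fst i $ fst j * B $ snd i $ snd j)"

definition basis_proj :: "'c \<Rightarrow> ('c :: finite) operator" where
  "basis_proj c = (\<chi> i j. if i = c \<and> j = c then 1 else 0)"

definition positive_op :: "('a :: finite) operator \<Rightarrow> bool" where
  "positive_op A \<longleftrightarrow> adjoint_op A = A \<and> (\<forall>x. 0 \<le> Re (cinner x (A *v x)))"

definition state :: "('a :: finite) operator \<Rightarrow> bool" where
  "state A \<longleftrightarrow> positive_op A \<and> trace A = 1"

definition supp :: "('a :: finite) operator \<Rightarrow> (complex ^ 'a) set" where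
  "supp A = {x. \<forall>y. A *v y = 0 \<longrightarrow> cinner y x = 0}"

text \<open>The subspace \<open>A \<otimes> S\<close>, where \<open>A\<close> is the whole space of the first register.\<close>

definition full_tensor :: "(complex ^ 'b) set \<Rightarrow> (complex ^ ('a :: finite \<times> 'b :: finite)) set" where
  "full_tensor S = vec.span {tensor_vec x y | x y. y \<in> S}"

definition unitary :: "('a :: finite) operator \<Rightarrow> bool" where
  "unitary U \<longleftrightarrow> adjoint_op U ** U = mat 1 \<and> U ** adjoint_op U = mat 1"

definition diag_op :: "('a :: finite \<Rightarrow> real) \<Rightarrow> 'a operator" where
  "diag_op d = (\<chi> i j. if i = j then complex_of_real (d i) else 0)"

text \<open>
  Real powers of a positive operator through a spectral decomposition. Since \<open>0 powr s = 0\<close>,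
  negative powers are taken on the support.
\<close>

definition op_powr :: "('a :: finite) operator \<Rightarrow> real \<Rightarrow> 'a operator" where
  "op_powr A s = (THE B. \<exists>U d. unitary U \<and> (\<forall>i. 0 \<le> d i) \<and>
     A = U ** diag_op d ** adjoint_op U \<and>
     B = U ** diag_op (\<lambda>i. d i powr s) ** adjoint_op U)"

lemma diag_op_mult_left: "(diag_op d ** X) $ i $ j = complex_of_real (d i) * X $ i $ j"
  by (simp add: matrix_matrix_mult_def diag_op_def if_distrib[of "\<lambda>z. z * _"] sum.delta
      cong: if_cong)

lemma diag_op_mult_right: "(X ** diag_op d) $ i $ j = X $ i $ j * complex_of_real (d j)"
  by (simp add: matrix_matrix_mult_def diag_op_def if_distrib[of "\<lambda>z. _ * z"] sum.delta
      cong: if_cong)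

text \<open>The power does not depend on the spectral decomposition that is chosen.\<close>

lemma op_powr_eq:
  assumes U: "unitary U" and d: "\<And>i. 0 \<le> d i" and A: "A = U ** diag_op d ** adjoint_op U"
  shows "op_powr A s = U ** diag_op (\<lambda>i. d i powr s) ** adjoint_op U"
  unfolding op_powr_def
proof (rule the_equality)
  fix B
  assume "\<exists>W e. unitary W \<and> (\<forall>i. 0 \<le> e i) \<and> A = W ** diag_op e ** adjoint_op W \<and>
    B = W ** diag_op (\<lambda>i. e i powr s) ** adjoint_op W"
  then obtain W e where W: "unitary W" and A': "A = W ** diag_op e ** adjoint_op W"
    and B: "B = W ** diag_op (\<lambda>i. e i powr s) ** adjoint_op W" by blast
  define X where "X = adjoint_op W ** U"
  have UU: "adjoint_op U ** U = mat 1" "U ** adjoint_op U = mat 1"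
    and WW: "adjoint_op W ** W = mat 1" "W ** adjoint_op W = mat 1"
    using U W by (auto simp: unitary_def)
  have "diag_op e ** X = adjoint_op W ** A ** U"
    unfolding A' X_def by (metis WW(1) matrix_mul_assoc matrix_mul_lid)
  also have "\<dots> = X ** diag_op d"
    unfolding A X_def by (metis UU(1) matrix_mul_assoc matrix_mul_rid)
  finally have "(diag_op e ** X) $ i $ j = (X ** diag_op d) $ i $ j" for i j by simp
  then have "X $ i $ j = 0 \<or> e i = d j" for i j
    by (simp add: diag_op_mult_left diag_op_mult_right)
  then have "diag_op (\<lambda>i. e i powr s) ** X = X ** diag_op (\<lambda>i. d i powr s)"
    unfolding vec_eq_iff diag_op_mult_left diag_op_mult_right
    by (metis mult.commute mult_zero_left)
  then have "W ** (diag_op (\<lambda>i. e i powr s) ** X) ** adjoint_op U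
      = W ** (X ** diag_op (\<lambda>i. d i powr s)) ** adjoint_op U" by simp
  moreover have "W ** (diag_op (\<lambda>i. e i powr s) ** X) ** adjoint_op U = B"
    unfolding B X_def by (metis UU(2) matrix_mul_assoc matrix_mul_rid)
  moreover have "W ** (X ** diag_op (\<lambda>i. d i powr s)) ** adjoint_op U
      = U ** diag_op (\<lambda>i. d i powr s) ** adjoint_op U"
    unfolding X_def by (metis WW(2) matrix_mul_assoc matrix_mul_lid)
  ultimately show "B = U ** diag_op (\<lambda>i. d i powr s) ** adjoint_op U" by simp
qed (use assms in blast)

text \<open>
  In both definitions the operator lives on the register \<open>'a \<times> 'b\<close>, and the conditioning register
  is \<open>'b\<close>. The operator \<open>\<sigma>\<close> on \<open>'b\<close> acts as the identity on \<open>'a\<close>.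
\<close>

definition renyi_rel ::
    "real \<Rightarrow> ('a :: finite \<times> 'b :: finite) operator \<Rightarrow> 'b operator \<Rightarrow> ereal" where
  "renyi_rel \<alpha> \<rho> \<sigma> =
    (if supp \<rho> \<subseteq> full_tensor (supp \<sigma>)
     then let S = tensor_op (mat 1) (op_powr \<sigma> ((1 - \<alpha>) / (2 * \<alpha>)))
          in ereal (1 / (1 - \<alpha>) * log 2 (Re (trace (op_powr (S ** \<rho> ** S) \<alpha>))))
     else - \<infinity>)"

text \<open>
  The supremum over all states is a maximum, since the set of states is compact and, for
  \<open>\<alpha> > 1\<close>, the entropy is upper semicontinuous in \<open>\<sigma>\<close>.
\<close>

definition renyi_entropy ::
    "real \<Rightarrow> ('a :: finite \<times> 'b :: finite) operator \<Rightarrow> ereal" where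
  "renyi_entropy \<alpha> \<rho> = (SUP \<sigma> \<in> {\<sigma>. state \<sigma>}. renyi_rel \<alpha> \<rho> \<sigma>)"

definition classical_mid ::
    "('a :: finite \<times> 'c :: finite \<times> 'e :: finite) operator \<Rightarrow> bool" where
  "classical_mid \<rho> \<longleftrightarrow>
    (\<forall>a c e a' c' e'. c \<noteq> c' \<longrightarrow> \<rho> $ (a, c, e) $ (a', c', e') = 0)"

text \<open>
  The state on the first register conditioned on the outcome \<open>c\<close> of the classical middle register.
  It is the zero operator, with support \<open>{0}\<close>, if \<open>c\<close> has probability \<open>0\<close>.
\<close>

definition cond_state ::
    "('a :: finite \<times> 'c :: finite \<times> 'e :: finite) operator \<Rightarrow> 'c \<Rightarrow> 'a operator" where
  "cond_state \<rho> c =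
    (\<chi> a a'. (\<Sum>e\<in>UNIV. \<rho> $ (a, c, e) $ (a', c, e)) /
             (\<Sum>b\<in>UNIV. \<Sum>e\<in>UNIV. \<rho> $ (b, c, e) $ (b, c, e)))"

text \<open>
  An isometry defined on a subspace \<open>S\<close> only is represented by an arbitrary linear extension to the
  whole space; nothing is required of it outside \<open>S\<close>.
\<close>

definition isometry_on :: "(complex ^ 'a) set \<Rightarrow> complex ^ 'a ^ 'b \<Rightarrow> bool" where
  "isometry_on S W \<longleftrightarrow> (\<forall>x\<in>S. norm (W *v x) = norm x)"

definition controlled_op ::
    "('c :: finite \<Rightarrow> complex ^ 'a ^ 'b) \<Rightarrow>
     complex ^ ('a \<times> 'c \<times> 'e :: finite) ^ ('b \<times> 'c \<times> 'e)" where
  "controlled_op W = (\<Sum>c\<in>UNIV. tensor_op (W c) (tensor_op (basis_proj c) (mat 1)))"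

end

theory Submission
  imports Defs
begin

text \<open>
  Write \<open>\<rho> = K K\<^sup>\<dagger>\<close> and \<open>\<beta> = (\<alpha> - 1) / \<alpha>\<close>. Since \<open>Y Y\<^sup>\<dagger>\<close> and \<open>Y\<^sup>\<dagger> Y\<close> have the same nonzero
  spectrum, the trace in the entropy relative to \<open>\<sigma>\<close> is \<open>Tr G\<^sup>\<alpha>\<close>, where \<open>G\<close> is
  \<open>K\<^sup>\<dagger> (1 \<otimes> \<sigma> powr -\<beta>) K\<close>. If \<open>\<sigma>\<close> is block diagonal in the classical register, then \<open>1 \<otimes> \<sigma>\<close>
  commutes with the controlled isometry, so \<open>G\<close> is the same for both states. It remains to see that
  for a classical state pinching \<open>\<sigma>\<close> does not decrease the entropy: by operator convexity of
  \<open>t powr -\<beta>\<close> (an integral of resolvents), the operator \<open>G\<close> of the pinched \<open>\<sigma>\<close> is at most the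
  pinched \<open>G\<close>, and pinching does not increase \<open>Tr G\<^sup>\<alpha>\<close> by convexity of \<open>t powr \<alpha>\<close>.
\<close>

section \<open>Inner product and adjoint\<close>

text \<open>The obstacle is that the isometries act only on subspaces and change the size of the
  first register, so they may have no unitary extension, and powers of the transformed state cannot
  be computed by plain conjugation. With \<open>L = V K\<close> as a factor of the second state,
  both operators \<open>G\<close> live on the domain of \<open>K\<close>, and \<open>V\<close>
  enters only through inner products of vectors obtained from \<open>K y\<close> by powers of
  \<sigma>. For block diagonal \<sigma> these vectors stay where \<open>V\<close> is isometric. For
  other \<sigma>, components with different classical values, on which different isometries act, are
  mixed; the relative entropies of the two states can then differ, and only the suprema can be
  compared. The assumption \<alpha> > 1 enters twice: it puts \<beta> between 0 and 1, exactly where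
  the integral of \<open>s powr -\<beta> / (t + s)\<close> converges, and it makes the factor
  \<open>1 / (1 - \<alpha>)\<close> negative, so that a smaller trace means a larger entropy. A
  singular \<sigma> needs care because resolvents at eigenvalue 0 blow up as \<open>s\<close> tends
  to 0; the support condition is therefore carried along as a condition on the components of
  \<open>K y\<close>.\<close>

lemma cinner_commute: "cnj (cinner x y) = cinner y x"
  by (simp add: cinner_def mult.commute)

lemma cinner_add_right: "cinner x (y + z) = cinner x y + cinner x z"
  and cinner_diff_right: "cinner x (y - z) = cinner x y - cinner x z"
  and cinner_scale_right: "cinner x (c *s y) = c * cinner x y"
  and cinner_zero_right [simp]: "cinner x 0 = 0"
  by (simp_all add: cinner_def algebra_simps sum.distrib sum_subtractf sum_distrib_left)

lemma cinner_scale_left: "cinner (c *s x) z = cnj c * cinner x z"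
  and cinner_zero_left [simp]: "cinner 0 z = 0"
  by (simp_all add: cinner_def algebra_simps sum_distrib_left)

lemma cinner_sum_right: "cinner x (\<Sum>i\<in>A. f i) = (\<Sum>i\<in>A. cinner x (f i))"
  by (induction A rule: infinite_finite_induct) (simp_all add: cinner_add_right)

lemma Re_cinner: "Re (cinner x y) = inner x y"
  by (simp add: cinner_def inner_vec_def inner_complex_def)

lemma cinner_self: "cinner x x = complex_of_real ((norm x)\<^sup>2)"
proof -
  have "Im (cinner x x) = 0"
    by (simp add: cinner_def algebra_simps)
  then show ?thesis
    by (simp add: complex_eq_iff Re_cinner power2_norm_eq_inner)
qed

lemma cinner_eq_zero_iff [simp]: "cinner x x = 0 \<longleftrightarrow> x = 0"
  by (simp add: cinner_self)

lemma adjoint_op_adjoint_op [simp]: "adjoint_op (adjoint_op A) = A"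
  by (simp add: adjoint_op_def vec_eq_iff)

lemma adjoint_op_mult: "adjoint_op (A ** B) = adjoint_op B ** adjoint_op A"
  for A :: "complex ^ 'b::finite ^ 'c" and B :: "complex ^ 'a ^ 'b"
  by (simp add: adjoint_op_def vec_eq_iff matrix_matrix_mult_def mult.commute)

lemma cinner_adjoint_op: "cinner x (A *v y) = cinner (adjoint_op A *v x) y"
  for A :: "complex ^ 'a::finite ^ 'b::finite"
  unfolding cinner_def matrix_vector_mult_def adjoint_op_def
  by (simp add: sum_distrib_left sum_distrib_right mult_ac) (rule sum.swap)

lemma cinner_adjoint_op_left: "cinner (A *v y) x = cinner y (adjoint_op A *v x)"
  for A :: "complex ^ 'a::finite ^ 'b::finite"
  by (metis adjoint_op_adjoint_op cinner_adjoint_op)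

lemma adjoint_diag_op [simp]: "adjoint_op (diag_op d) = diag_op d"
  by (simp add: adjoint_op_def diag_op_def vec_eq_iff)

lemma diag_op_mult: "diag_op d ** diag_op e = diag_op (\<lambda>i. d i * e i)"
  by (simp add: vec_eq_iff diag_op_mult_left) (simp add: diag_op_def)

lemma diag_op_mult_vec: "(diag_op d *v x) $ i = complex_of_real (d i) * x $ i"
  by (simp add: matrix_vector_mult_def diag_op_def if_distrib[of "\<lambda>z. z * _"] cong: if_cong)

lemma gram_entry: "(adjoint_op A ** B) $ i $ j = cinner (column i A) (column j B)"
  for A :: "complex ^ 'a ^ 'b::finite"
  by (simp add: adjoint_op_def matrix_matrix_mult_def cinner_def column_def)

lemma column_matrix_mult: "column j (A ** B) = A *v column j B"
  by (simp add: vec_eq_iff matrix_matrix_mult_def matrix_vector_mult_def column_def)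

lemma adjoint_mult_vec_nth: "(adjoint_op A *v x) $ i = cinner (column i A) x"
  by (simp add: adjoint_op_def matrix_vector_mult_def cinner_def column_def)

lemma sandwich_entry: "(adjoint_op W ** A ** W) $ i $ j = cinner (column i W) (A *v column j W)"
  for W :: "complex ^ 'a ^ 'b::finite"
  by (metis gram_entry column_matrix_mult matrix_mul_assoc)

section \<open>Spectral theorem\<close>

text \<open>The conjugated \<open>u j\<close> fill only the rows labelled by \<open>J\<close>, so
  row \<open>k\<close> is zero, the square matrix is singular, and a kernel vector does the
  job.\<close>

lemma exists_orthogonal:
  fixes u :: "'a::finite \<Rightarrow> complex ^ 'a"
  assumes "k \<notin> J"
  shows "\<exists>x. x \<noteq> 0 \<and> (\<forall>j\<in>J. cinner (u j) x = 0)"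
proof -
  define M :: "complex ^ 'a ^ 'a" where "M = (\<chi> i j. if i \<in> J then cnj (u i $ j) else 0)"
  have *: "B ** M \<noteq> mat 1" for B
  proof
    assume "B ** M = mat 1"
    then have "M ** B = mat 1" by (simp add: matrix_left_right_inverse)
    then have "(M ** B) $ k $ k = 1" by (simp add: mat_def)
    then show False using assms by (simp add: matrix_matrix_mult_def M_def)
  qed
  then obtain x where x: "M *v x = 0" "x \<noteq> 0"
    using matrix_left_invertible_ker[of M] by blast
  have "cinner (u j) x = 0" if "j \<in> J" for j
  proof -
    have "(M *v x) $ j = 0" using x by simp
    then show ?thesis using that by (simp add: matrix_vector_mult_def M_def cinner_def)
  qed
  then show ?thesis using x by blast
qed

text \<open>A maximizer of the Rayleigh quotient on an invariant subspace is an eigenvector.\<close>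

lemma exists_eigenvector:
  fixes A :: "('a::finite) operator" and J :: "'i set" and u :: "'i \<Rightarrow> complex ^ 'a"
  defines "W \<equiv> {x. \<forall>j\<in>J. cinner (u j) x = 0}"
  assumes A: "adjoint_op A = A" and inv: "\<And>x. x \<in> W \<Longrightarrow> A *v x \<in> W"
    and x0: "x0 \<in> W" "x0 \<noteq> 0"
  shows "\<exists>x l. x \<in> W \<and> norm x = 1 \<and> A *v x = complex_of_real l *s x"
proof -
  define f where "f x = inner x (A *v x)" for x
  have lin: "bounded_linear ((*v) A)" by (rule matrix_vector_mul_bounded_linear)
  have cl: "closed W"
  proof -
    have "W = (\<Inter>j\<in>J. {x. cinner (u j) x = 0})" by (auto simp: W_def)
    moreover have "closed {x. cinner (u j) x = 0}" for j
      unfolding cinner_def by (intro closed_Collect_eq continuous_intros)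
    ultimately show ?thesis by auto
  qed
  have Wadd: "x + y \<in> W" "x - y \<in> W" "c *s x \<in> W" if "x \<in> W" "y \<in> W" for x y c
    using that by (auto simp: W_def cinner_add_right cinner_diff_right cinner_scale_right)
  have scaleR: "r *\<^sub>R x = complex_of_real r *s x" for r and x :: "complex ^ 'a"
    by (simp add: vec_eq_iff scaleR_conv_of_real[where 'a = complex])
  have "compact (W \<inter> sphere 0 1)" using cl by (simp add: closed_Int_compact)
  moreover have "W \<inter> sphere 0 1 \<noteq> {}"
  proof -
    have "x0 /\<^sub>R norm x0 \<in> W"
      using Wadd(3)[OF x0(1) x0(1)] by (simp add: scaleR)
    moreover have "x0 /\<^sub>R norm x0 \<in> sphere 0 1" using x0(2) by simp
    ultimately show ?thesis by blast
  qed
  moreover have "continuous_on (W \<inter> sphere 0 1) f"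
    unfolding f_def
    by (intro continuous_intros linear_continuous_on lin)
  ultimately obtain x where x': "x \<in> W \<inter> sphere 0 1"
    and mx: "\<forall>y\<in>W \<inter> sphere 0 1. f y \<le> f x"
    using continuous_attains_sup[of "W \<inter> sphere 0 1" f] by blast
  have x: "x \<in> W" "norm x = 1" using x' by auto
  have fsc: "f (r *\<^sub>R y) = r\<^sup>2 * f y" for r y
    using lin by (simp add: f_def linear_simps power2_eq_square)
  have mx': "f y \<le> f x * (norm y)\<^sup>2" if "y \<in> W" for y
  proof (cases "y = 0")
    case False
    have "inverse (norm y) *\<^sub>R y \<in> W"
      using Wadd(3)[OF that that] by (simp add: scaleR)
    moreover have "inverse (norm y) *\<^sub>R y \<in> sphere 0 1" using False by simp
    ultimately have "f (inverse (norm y) *\<^sub>R y) \<le> f x" using mx by blast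
    then show ?thesis using False by (simp add: fsc field_simps)
  qed (simp add: f_def)
  have sym: "inner a (A *v b) = inner b (A *v a)" for a b
    by (metis A Re_cinner cinner_adjoint_op inner_commute)
  \<comment> \<open>The residual of the eigenvalue equation. Moving from \<open>x\<close> along
    \<open>y\<close> changes \<open>f\<close> minus \<open>f x\<close> times the squared norm by
    \<open>2 * t * (norm y)\<^sup>2\<close> to first order, so maximality will force
    \<open>y = 0\<close>.\<close>
  define y where "y = A *v x - f x *\<^sub>R x"
  have yW: "y \<in> W" unfolding y_def scaleR using x inv Wadd by blast
  define q where "q = f y - f x * (norm y)\<^sup>2"
  have q: "q \<le> 0" using mx'[OF yW] by (simp add: q_def)
  have key: "2 * t * (norm y)\<^sup>2 + t\<^sup>2 * q \<le> 0" for t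
  proof -
    have "x + t *\<^sub>R y \<in> W" using x yW Wadd unfolding scaleR by blast
    from mx'[OF this] have "f (x + t *\<^sub>R y) \<le> f x * (norm (x + t *\<^sub>R y))\<^sup>2" .
    moreover have "f (x + t *\<^sub>R y) = f x + 2 * t * inner y (A *v x) + t\<^sup>2 * f y"
      using sym[of x y] lin
      by (simp add: f_def linear_simps inner_add_left inner_add_right power2_eq_square algebra_simps)
    moreover have "(norm (x + t *\<^sub>R y))\<^sup>2 = 1 + 2 * t * inner y x + t\<^sup>2 * (norm y)\<^sup>2"
    proof -
      have "inner x x = 1" using x(2) by (simp only: norm_eq_1)
      then show ?thesis
        unfolding power2_norm_eq_inner inner_add_left inner_add_right
          inner_scaleR_left inner_scaleR_right
        using inner_commute[of x y] by (simp add: power2_eq_square algebra_simps)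
    qed
    moreover have "(norm y)\<^sup>2 = inner y (A *v x) - f x * inner y x"
    proof -
      have "inner y y = inner y (A *v x) - f x * inner y x"
        by (subst (2) y_def) (simp add: inner_diff_right)
      then show ?thesis by (simp only: power2_norm_eq_inner)
    qed
    then have "2 * t * (norm y)\<^sup>2 = 2 * t * inner y (A *v x) - f x * (2 * t * inner y x)"
      by (simp only:) (simp only: algebra_simps)
    ultimately show ?thesis
      by (simp only: q_def algebra_simps)
  qed
  have "norm y = 0"
  proof (rule ccontr)
    assume "norm y \<noteq> 0"
    define N where "N = (norm y)\<^sup>2"
    have N: "N > 0" using \<open>norm y \<noteq> 0\<close> by (simp add: N_def)
    \<comment> \<open>With \<open>t * (1 - q) = N\<close> the quantity \<open>2 * N + t * q\<close>
      equals \<open>N + t\<close>, which is positive. The 1 keeps the denominator positive when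
      \<open>q = 0\<close>.\<close>
    define t where "t = N / (1 - q)"
    have t: "t > 0" "t * (1 - q) = N" using N q by (auto simp: t_def)
    have "t * (2 * N + t * q) \<le> 0"
      using key[of t] by (simp add: N_def power2_eq_square algebra_simps)
    then have "2 * N + t * q \<le> 0" using t by (simp add: mult_le_0_iff)
    then show False using t N by (simp add: algebra_simps)
  qed
  then have "A *v x = complex_of_real (f x) *s x" by (simp add: y_def scaleR)
  then show ?thesis using x by blast
qed

lemma exists_orthonormal_eigenvectors:
  fixes A :: "('a::finite) operator" and J :: "'a set"
  assumes A: "adjoint_op A = A"
  shows "\<exists>u l. (\<forall>i\<in>J. \<forall>j\<in>J. cinner (u i) (u j) = (if i = j then 1 else 0)) \<and>
               (\<forall>i\<in>J. A *v u i = complex_of_real (l i) *s u i)"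
proof (induction J rule: finite_induct[OF finite])
  case (2 k J)
  then obtain u l where u: "\<And>i j. i \<in> J \<Longrightarrow> j \<in> J \<Longrightarrow> cinner (u i) (u j) = (if i = j then 1 else 0)"
    and l: "\<And>i. i \<in> J \<Longrightarrow> A *v u i = complex_of_real (l i) *s u i" by blast
  obtain x0 where x0: "x0 \<noteq> 0" "\<forall>j\<in>J. cinner (u j) x0 = 0"
    using exists_orthogonal[OF \<open>k \<notin> J\<close>] by blast
  have "cinner (u j) (A *v x) = 0" if "\<forall>j\<in>J. cinner (u j) x = 0" "j \<in> J" for x j
    using that by (simp add: cinner_adjoint_op A l cinner_scale_left)
  then obtain x m where x: "\<forall>j\<in>J. cinner (u j) x = 0" "norm x = 1"
    and m: "A *v x = complex_of_real m *s x"
    using exists_eigenvector[OF A, of J u x0] x0 by auto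
  have x': "cinner x (u j) = 0" if "j \<in> J" for j
    using that x by (metis cinner_commute complex_cnj_zero)
  show ?case
    using 2(2) x x' u l m cinner_self[of x]
    by (intro exI[of _ "u(k := x)"] exI[of _ "l(k := m)"]) auto
qed auto

lemma spectral_decomposition:
  fixes A :: "('a::finite) operator"
  assumes "positive_op A"
  obtains U d where "unitary U" "\<And>i. 0 \<le> d i" "A = U ** diag_op d ** adjoint_op U"
proof -
  have A: "adjoint_op A = A" using assms by (simp add: positive_op_def)
  obtain u :: "'a \<Rightarrow> complex ^ 'a" and l
    where u: "\<And>i j. cinner (u i) (u j) = (if i = j then 1 else 0)"
    and l: "\<And>i. A *v u i = complex_of_real (l i) *s u i"
    using exists_orthonormal_eigenvectors[OF A, of UNIV] by blast
  define U where "U = (\<chi> i j. u j $ i)"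
  have col: "column j U = u j" for j by (simp add: column_def U_def)
  have 1: "adjoint_op U ** U = mat 1"
    by (simp add: vec_eq_iff gram_entry col u mat_def)
  then have 2: "U ** adjoint_op U = mat 1" by (simp add: matrix_left_right_inverse)
  have "adjoint_op U ** A ** U = diag_op l"
    by (simp add: vec_eq_iff sandwich_entry col l cinner_scale_right u diag_op_def)
  then have "A = U ** diag_op l ** adjoint_op U"
    by (metis 2 matrix_mul_assoc matrix_mul_lid matrix_mul_rid)
  moreover have "0 \<le> l i" for i
  proof -
    have "0 \<le> Re (cinner (u i) (A *v u i))" using assms by (simp add: positive_op_def)
    then show ?thesis by (simp add: l cinner_scale_right u)
  qed
  ultimately show ?thesis using that 1 2 by (auto simp: unitary_def)
qed

section \<open>Powers of positive operators\<close>

lemma unitary_cancel: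
  assumes "unitary U"
  shows "adjoint_op U ** U = mat 1" "U ** adjoint_op U = mat 1"
    and "X ** adjoint_op U ** U = X" "X ** U ** adjoint_op U = X"
  using assms by (simp_all add: unitary_def flip: matrix_mul_assoc)

lemma unitary_columns:
  assumes "unitary U"
  shows "cinner (column i U) (column j U) = (if i = j then 1 else 0)"
  using assms by (simp add: unitary_def mat_def flip: gram_entry)

lemma parseval:
  assumes "unitary U"
  shows "(\<Sum>i\<in>UNIV. (cmod (cinner (column i U) x))\<^sup>2) = (norm x)\<^sup>2"
proof -
  have "cinner (adjoint_op U *v x) (adjoint_op U *v x) = cinner x x"
    using assms
    by (simp add: cinner_adjoint_op[of _ "adjoint_op U"] matrix_vector_mul_assoc unitary_def)
  then have "(norm (adjoint_op U *v x))\<^sup>2 = (norm x)\<^sup>2"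
    unfolding cinner_self of_real_eq_iff .
  then show ?thesis
    by (simp add: norm_vec_def L2_set_def sum_nonneg adjoint_mult_vec_nth)
qed

lemma spectral_mult_column:
  assumes "unitary U" and "A = U ** diag_op d ** adjoint_op U"
  shows "A *v column i U = complex_of_real (d i) *s column i U"
proof -
  have "A ** U = U ** diag_op d"
    by (simp add: assms unitary_cancel)
  then have "A *v column i U = column i (U ** diag_op d)"
    by (simp only: column_matrix_mult[symmetric])
  also have "\<dots> = complex_of_real (d i) *s column i U"
    by (simp add: vec_eq_iff column_def diag_op_mult_right mult.commute)
  finally show ?thesis .
qed

lemma spectral_form:
  fixes U :: "('a::finite) operator"
  shows "cinner x ((U ** diag_op d ** adjoint_op U) *v y) =
    (\<Sum>i\<in>UNIV. complex_of_real (d i) * (cnj (cinner (column i U) x) * cinner (column i U) y))"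
proof -
  have "cinner x ((U ** diag_op d ** adjoint_op U) *v y) =
      cinner (adjoint_op U *v x) (diag_op d *v (adjoint_op U *v y))"
    by (simp add: cinner_adjoint_op_left matrix_vector_mul_assoc matrix_mul_assoc)
  then show ?thesis
    by (simp add: cinner_def[of "adjoint_op U *v x"] diag_op_mult_vec adjoint_mult_vec_nth mult_ac)
qed

lemma spectral_quadratic_form:
  fixes U :: "('a::finite) operator"
  shows "Re (cinner x ((U ** diag_op d ** adjoint_op U) *v x)) =
    (\<Sum>i\<in>UNIV. d i * (cmod (cinner (column i U) x))\<^sup>2)"
  by (simp add: spectral_form complex_norm_square[symmetric] mult.commute[of "cnj _"]
      flip: of_real_mult)

lemma trace_spectral:
  assumes "unitary U"
  shows "trace (U ** diag_op d ** adjoint_op U) = complex_of_real (\<Sum>i\<in>UNIV. d i)"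
proof -
  have "trace (U ** diag_op d ** adjoint_op U) = trace (adjoint_op U ** (U ** diag_op d))"
    by (rule trace_mul_sym)
  also have "\<dots> = trace (diag_op d)"
    using assms by (simp add: matrix_mul_assoc unitary_cancel)
  finally show ?thesis by (simp add: trace_def diag_op_def)
qed

lemma op_powr_spectral:
  assumes "positive_op A"
  obtains U d where "unitary U" "\<And>i. 0 \<le> d i" "A = U ** diag_op d ** adjoint_op U"
    "\<And>s. op_powr A s = U ** diag_op (\<lambda>i. d i powr s) ** adjoint_op U"
proof -
  obtain U d where U: "unitary U" and d: "\<And>i. 0 \<le> d i"
    and A: "A = U ** diag_op d ** adjoint_op U"
    by (rule spectral_decomposition[OF assms]) blast
  show thesis by (rule that[OF U d A op_powr_eq[OF U d A]])
qed

lemma trace_op_powr: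
  assumes "unitary U" "\<And>i. 0 \<le> d i" "A = U ** diag_op d ** adjoint_op U"
  shows "Re (trace (op_powr A s)) = (\<Sum>i\<in>UNIV. d i powr s)"
  unfolding op_powr_eq[OF assms] trace_spectral[OF assms(1)] by simp

lemma adjoint_op_powr:
  assumes "positive_op A"
  shows "adjoint_op (op_powr A s) = op_powr A s"
proof -
  obtain U d where U: "unitary U" and d: "\<And>i. 0 \<le> d i"
    and A: "A = U ** diag_op d ** adjoint_op U"
    and P: "\<And>s. op_powr A s = U ** diag_op (\<lambda>i. d i powr s) ** adjoint_op U"
    by (rule op_powr_spectral[OF assms]) blast
  show ?thesis by (simp add: P adjoint_op_mult matrix_mul_assoc)
qed

text \<open>Exponents of any sign are allowed because \<open>0 powr s = 0\<close> for every
  \<open>s\<close>, also for \<open>s = 0\<close>: both sides vanish on the kernel. In particular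
  \<open>op_powr A 0\<close> is the projection onto the support.\<close>

lemma op_powr_mult:
  assumes "positive_op A"
  shows "op_powr A s ** op_powr A t = op_powr A (s + t)"
proof -
  obtain U d where U: "unitary U" and d: "\<And>i. 0 \<le> d i"
    and A: "A = U ** diag_op d ** adjoint_op U"
    and P: "\<And>s. op_powr A s = U ** diag_op (\<lambda>i. d i powr s) ** adjoint_op U"
    by (rule op_powr_spectral[OF assms]) blast
  have "op_powr A s ** op_powr A t =
      U ** (diag_op (\<lambda>i. d i powr s) ** diag_op (\<lambda>i. d i powr t)) ** adjoint_op U"
    by (simp add: P matrix_mul_assoc unitary_cancel[OF U])
  then show ?thesis by (simp add: diag_op_mult P powr_add)
qed

lemma op_powr_one:
  assumes "positive_op A"
  shows "op_powr A 1 = A"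
proof -
  obtain U d where U: "unitary U" and d: "\<And>i. 0 \<le> d i"
    and A: "A = U ** diag_op d ** adjoint_op U"
    and P: "\<And>s. op_powr A s = U ** diag_op (\<lambda>i. d i powr s) ** adjoint_op U"
    by (rule op_powr_spectral[OF assms]) blast
  then show ?thesis using P[of 1] d by simp
qed

text \<open>In an eigenbasis of \<open>A\<close>, commuting with \<open>A\<close> means having
  nonzero entries only between equal eigenvalues, and equal eigenvalues have equal powers.\<close>

lemma op_powr_commute:
  assumes "positive_op A" and AX: "A ** X = X ** A"
  shows "op_powr A s ** X = X ** op_powr A s"
proof -
  obtain U d where U: "unitary U" and d: "\<And>i. 0 \<le> d i"
    and A: "A = U ** diag_op d ** adjoint_op U"
    and P: "\<And>s. op_powr A s = U ** diag_op (\<lambda>i. d i powr s) ** adjoint_op U"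
    by (rule op_powr_spectral[OF assms(1)]) blast
  define Y where "Y = adjoint_op U ** X ** U"
  note [simp] = unitary_cancel[OF U] and [simp] = matrix_mul_assoc
  have X: "X = U ** Y ** adjoint_op U"
    by (simp add: Y_def)
  have "diag_op d ** Y = adjoint_op U ** (A ** X) ** U"
    by (simp add: A Y_def)
  also have "\<dots> = Y ** diag_op d"
    unfolding AX by (simp add: A Y_def)
  finally have "(diag_op d ** Y) $ i $ j = (Y ** diag_op d) $ i $ j" for i j by simp
  then have "Y $ i $ j = 0 \<or> d i = d j" for i j
    by (simp add: diag_op_mult_left diag_op_mult_right)
  then have c: "diag_op (\<lambda>i. d i powr s) ** Y = Y ** diag_op (\<lambda>i. d i powr s)"
    unfolding vec_eq_iff diag_op_mult_left diag_op_mult_right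
    by (metis mult.commute mult_zero_left)
  have "op_powr A s ** X = U ** (diag_op (\<lambda>i. d i powr s) ** Y) ** adjoint_op U"
    by (simp add: P X)
  also have "\<dots> = X ** op_powr A s"
    unfolding c by (simp add: P X)
  finally show ?thesis .
qed

lemma positive_op_gram: "positive_op (adjoint_op Y ** Y)"
  for Y :: "complex ^ 'a::finite ^ 'b::finite"
  by (simp add: positive_op_def adjoint_op_mult cinner_adjoint_op[of _ "adjoint_op Y"]
      Re_cinner flip: matrix_vector_mul_assoc)

lemma positive_op_gram': "positive_op (Y ** adjoint_op Y)"
  for Y :: "complex ^ 'a::finite ^ 'b::finite"
  using positive_op_gram[of "adjoint_op Y"] by simp

text \<open>
  In eigenbases of \<open>Y Y\<^sup>\<dagger>\<close> and \<open>Y\<^sup>\<dagger> Y\<close>, the matrix \<open>X\<close> of \<open>Y\<close> only connects equal eigenvalues,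
  and the eigenvalues are the squared norms of its rows and of its columns.
\<close>

lemma trace_op_powr_gram:
  fixes Y :: "complex ^ 'a::finite ^ 'b::finite"
  shows "Re (trace (op_powr (Y ** adjoint_op Y) s)) = Re (trace (op_powr (adjoint_op Y ** Y) s))"
proof -
  obtain U d where U: "unitary U" and d: "\<And>i. 0 \<le> d i"
    and A: "Y ** adjoint_op Y = U ** diag_op d ** adjoint_op U"
    by (rule spectral_decomposition[OF positive_op_gram'[of Y]]) blast
  obtain W e where W: "unitary W" and e: "\<And>i. 0 \<le> e i"
    and B: "adjoint_op Y ** Y = W ** diag_op e ** adjoint_op W"
    by (rule spectral_decomposition[OF positive_op_gram[of Y]]) blast
  define X where "X = adjoint_op U ** Y ** W"
  note cancel = unitary_cancel[OF U] unitary_cancel[OF W]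
  have d': "X ** adjoint_op X = diag_op d"
  proof -
    have "X ** adjoint_op X = adjoint_op U ** (Y ** adjoint_op Y) ** U"
      by (simp add: X_def adjoint_op_mult matrix_mul_assoc cancel)
    also have "\<dots> = diag_op d"
      by (simp add: A matrix_mul_assoc cancel)
    finally show ?thesis .
  qed
  have e': "adjoint_op X ** X = diag_op e"
  proof -
    have "adjoint_op X ** X = adjoint_op W ** (adjoint_op Y ** Y) ** W"
      by (simp add: X_def adjoint_op_mult matrix_mul_assoc cancel)
    also have "\<dots> = diag_op e"
      by (simp add: B matrix_mul_assoc cancel)
    finally show ?thesis .
  qed
  have "diag_op d ** X = X ** diag_op e"
    by (simp add: matrix_mul_assoc flip: d' e')
  then have "(diag_op d ** X) $ i $ j = (X ** diag_op e) $ i $ j" for i j by simp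
  then have de: "X $ i $ j = 0 \<or> d i = e j" for i j
    by (simp add: diag_op_mult_left diag_op_mult_right)
  have d_row: "d i = (\<Sum>j\<in>UNIV. (cmod (X $ i $ j))\<^sup>2)" for i
  proof -
    have "complex_of_real (d i) = (X ** adjoint_op X) $ i $ i"
      unfolding d' by (simp add: diag_op_def)
    also have "\<dots> = complex_of_real (\<Sum>j\<in>UNIV. (cmod (X $ i $ j))\<^sup>2)"
      by (simp add: matrix_matrix_mult_def adjoint_op_def complex_norm_square del: of_real_power)
    finally show ?thesis by (simp only: of_real_eq_iff)
  qed
  have e_col: "e j = (\<Sum>i\<in>UNIV. (cmod (X $ i $ j))\<^sup>2)" for j
  proof -
    have "complex_of_real (e j) = (adjoint_op X ** X) $ j $ j"
      unfolding e' by (simp add: diag_op_def)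
    also have "\<dots> = complex_of_real (\<Sum>i\<in>UNIV. (cmod (X $ i $ j))\<^sup>2)"
      by (simp add: matrix_matrix_mult_def adjoint_op_def complex_norm_square mult.commute del: of_real_power)
    finally show ?thesis by (simp only: of_real_eq_iff)
  qed
  \<comment> \<open>One split-off factor can be expanded as a squared row norm or column norm of
    \<open>X\<close>; the remaining power may be taken of \<open>d i\<close> or of
    \<open>e j\<close>, which agree wherever \<open>X\<close> is nonzero.\<close>
  have pw: "x powr s = x powr (s - 1) * x" if "0 \<le> x" for x :: real
    using that powr_add[of x "s - 1" 1] by simp
  have "(\<Sum>i\<in>UNIV. d i powr s) = (\<Sum>i\<in>UNIV. \<Sum>j\<in>UNIV. d i powr (s - 1) * (cmod (X $ i $ j))\<^sup>2)"
    by (subst pw[OF d], subst (2) d_row) (simp add: sum_distrib_left)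
  also have "\<dots> = (\<Sum>i\<in>UNIV. \<Sum>j\<in>UNIV. e j powr (s - 1) * (cmod (X $ i $ j))\<^sup>2)"
    using de by (intro sum.cong refl) (metis mult_zero_right norm_zero zero_power2)
  also have "\<dots> = (\<Sum>j\<in>UNIV. e j powr s)"
    by (subst sum.swap, subst pw[OF e], subst (3) e_col) (simp add: sum_distrib_left)
  finally show ?thesis
    by (simp add: trace_op_powr[OF U d A] trace_op_powr[OF W e B])
qed

lemma supp_orthogonal:
  assumes "unitary U" "A = U ** diag_op d ** adjoint_op U" "x \<in> supp A" "d i = 0"
  shows "cinner (column i U) x = 0"
  using spectral_mult_column[OF assms(1,2), of i] assms(3,4)
  by (simp add: supp_def)

text \<open>A vector in the support has overlap only with eigenvectors of nonzero eigenvalue, and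
  their powers are nonzero.\<close>

lemma op_powr_supp_eq_zero:
  assumes "positive_op A" "x \<in> supp A" "op_powr A s *v x = 0"
  shows "x = 0"
proof -
  obtain U d where U: "unitary U" and d: "\<And>i. 0 \<le> d i"
    and A: "A = U ** diag_op d ** adjoint_op U"
    and P: "\<And>s. op_powr A s = U ** diag_op (\<lambda>i. d i powr s) ** adjoint_op U"
    by (rule op_powr_spectral[OF assms(1)]) blast
  have "(\<Sum>i\<in>UNIV. d i powr s * (cmod (cinner (column i U) x))\<^sup>2) = 0"
    using assms(3) unfolding P by (simp flip: spectral_quadratic_form)
  then have "d i powr s * (cmod (cinner (column i U) x))\<^sup>2 = 0" for i
    by (simp add: sum_nonneg_eq_0_iff)
  then have "cinner (column i U) x = 0" for i
    using supp_orthogonal[OF U A assms(2)] by (metis mult_eq_0_iff powr_eq_0_iff norm_eq_zero zero_eq_power2)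
  then show ?thesis using parseval[OF U, of x] by simp
qed

lemma supp_subspace: "vec.subspace (supp A)"
  by (auto simp: vec.subspace_def supp_def cinner_add_right cinner_scale_right)

section \<open>An integral representation of negative powers\<close>

text \<open>Substituting \<open>t * s\<close> for \<open>s\<close> pulls out the factor
  \<open>t powr -\<beta>\<close>, so \<open>C\<close> is the value of the integral at
  \<open>t = 1\<close>, namely pi / sin (pi \<beta>).\<close>

lemma nn_integral_resolvent:
  fixes \<beta> :: real
  assumes "0 < \<beta>" "\<beta> < 1"
  obtains C :: real where "0 < C"
    "\<And>t. 0 < t \<Longrightarrow> (\<integral>\<^sup>+ s. ennreal (indicator {0<..} s * (s powr -\<beta> / (t + s))) \<partial>lborel) =
      ennreal (C * t powr -\<beta>)"
proof -
  define k :: "real \<Rightarrow> real \<Rightarrow> real" where "k t s = indicator {0<..} s * (s powr -\<beta> / (t + s))" for t s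
  have k0: "0 \<le> k t s" if "0 < t" for t s
    using that by (simp add: k_def indicator_def)
  have meas [measurable]: "k t \<in> borel_measurable borel" for t
    unfolding k_def by measurable
  define I where "I = (\<integral>\<^sup>+ s. ennreal (k 1 s) \<partial>lborel)"
  \<comment> \<open>Splitting at 1: the bound \<open>s powr -\<beta>\<close> is integrable at 0
    since \<beta> < 1, and \<open>s powr (-\<beta> - 1)\<close> is integrable at infinity since
    \<beta> > 0.\<close>
  have "I \<le> (\<integral>\<^sup>+ s. ennreal (indicator {0..1} s * s powr -\<beta>) +
                 ennreal (indicator {1..} s * s powr (-\<beta> - 1)) \<partial>lborel)"
    unfolding I_def
  proof (intro nn_integral_mono)
    fix s :: real
    have "k 1 s \<le> indicator {0..1} s * s powr -\<beta> + indicator {1..} s * s powr (-\<beta> - 1)"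
    proof (cases "s \<le> 1")
      case True
      then have "s powr -\<beta> / (1 + s) \<le> s powr -\<beta> / 1" if "s > 0"
        using that by (intro divide_left_mono) auto
      then show ?thesis using True by (auto simp: k_def indicator_def add_increasing2)
    next
      case False
      then have "s powr -\<beta> / (1 + s) \<le> s powr -\<beta> / s"
        by (intro divide_left_mono) auto
      also have "\<dots> = s powr (-\<beta> - 1)" using False by (simp add: powr_diff)
      finally show ?thesis using False by (auto simp: k_def indicator_def)
    qed
    then show "ennreal (k 1 s) \<le> ennreal (indicator {0..1} s * s powr -\<beta>) +
                 ennreal (indicator {1..} s * s powr (-\<beta> - 1))"
      by (simp add: ennreal_leI flip: ennreal_plus)
  qed
  also have "\<dots> = (\<integral>\<^sup>+ s. ennreal (indicator {0..1} s * s powr -\<beta>) \<partial>lborel) +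
                 (\<integral>\<^sup>+ s. ennreal (indicator {1..} s * s powr (-\<beta> - 1)) \<partial>lborel)"
    by (rule nn_integral_add) measurable
  also have "(\<integral>\<^sup>+ s. ennreal (indicator {0..1} s * s powr -\<beta>) \<partial>lborel) = ennreal (1 powr (-\<beta> + 1) / (-\<beta> + 1))"
    by (rule nn_integral_has_integral_lebesgue[OF _ has_integral_powr_from_0]) (use assms in auto)
  also have "(\<integral>\<^sup>+ s. ennreal (indicator {1..} s * s powr (-\<beta> - 1)) \<partial>lborel) =
      ennreal (- (1 powr (-\<beta> - 1 + 1)) / (-\<beta> - 1 + 1))"
    by (rule nn_integral_has_integral_lebesgue[OF _ has_integral_powr_to_inf]) (use assms in auto)
  finally have fin: "I < \<infinity>" by (auto simp: less_top intro: le_less_trans)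
  have pos: "I \<noteq> 0"
  proof
    assume "I = 0"
    then have "AE s in lborel. ennreal (k 1 s) = 0"
      unfolding I_def by (subst (asm) nn_integral_0_iff_AE) auto
    moreover have "0 < k 1 s" if "s \<in> {0<..<1}" for s
      using that by (simp add: k_def)
    ultimately have "AE s in lborel. s \<notin> {0<..<1::real}"
      by (auto elim!: eventually_mono simp: ennreal_eq_0_iff simp flip: not_le)
    then have "emeasure lborel {0<..<1::real} = 0"
      by (subst (asm) AE_iff_measurable[where N = "{0<..<1}"]) auto
    then show False by simp
  qed
  have scale: "(\<integral>\<^sup>+ s. ennreal (k t s) \<partial>lborel) = ennreal (t powr -\<beta>) * I" if t: "0 < t" for t
  proof -
    have kt: "k t (0 + t * s) = t powr -\<beta> / t * k 1 s" for s
    proof (cases "s > 0")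
      case True
      have "t + t * s = t * (1 + s)" by (simp add: algebra_simps)
      then show ?thesis using t True by (simp add: k_def powr_mult indicator_def)
    next
      case False
      then show ?thesis using t by (simp add: k_def indicator_def zero_less_mult_iff)
    qed
    have "(\<integral>\<^sup>+ s. ennreal (k t s) \<partial>lborel) = ennreal \<bar>t\<bar> * (\<integral>\<^sup>+ s. ennreal (k t (0 + t * s)) \<partial>lborel)"
      using t by (intro nn_integral_real_affine) auto
    also have "\<dots> = ennreal \<bar>t\<bar> * (\<integral>\<^sup>+ s. ennreal (t powr -\<beta> / t * k 1 s) \<partial>lborel)"
      by (simp only: kt)
    also have "(\<integral>\<^sup>+ s. ennreal (t powr -\<beta> / t * k 1 s) \<partial>lborel) = ennreal (t powr -\<beta> / t) * I"
    proof -
      have "ennreal (t powr -\<beta> / t * k 1 s) = ennreal (t powr -\<beta> / t) * ennreal (k 1 s)" for s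
        using t k0[of 1] by (intro ennreal_mult) auto
      then show ?thesis unfolding I_def by (simp only:) (rule nn_integral_cmult, measurable)
    qed
    also have "ennreal \<bar>t\<bar> * (ennreal (t powr -\<beta> / t) * I) = ennreal (t powr -\<beta>) * I"
      using t by (simp add: mult.assoc[symmetric] flip: ennreal_mult)
    finally show ?thesis .
  qed
  obtain C where C: "I = ennreal C" "0 < C"
  proof
    show "I = ennreal (enn2real I)" using fin by simp
    show "0 < enn2real I" using fin pos by (simp add: enn2real_positive_iff zero_less_iff_neq_zero)
  qed
  show ?thesis
    using C scale by (intro that[of C]) (auto simp: k_def ennreal_mult mult.commute)
qed

lemma nn_integral_sum_resolvent:
  fixes c r :: "'k \<Rightarrow> real"
  assumes C: "\<And>t. 0 < t \<Longrightarrow>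
      (\<integral>\<^sup>+ s. ennreal (indicator {0<..} s * (s powr -\<beta> / (t + s))) \<partial>lborel) = ennreal (C * t powr -\<beta>)"
    and C0: "0 < C"
    and r: "\<And>i. i \<in> K \<Longrightarrow> 0 < r i" and c: "\<And>i. i \<in> K \<Longrightarrow> 0 \<le> c i"
  shows "(\<integral>\<^sup>+ s. ennreal (indicator {0<..} s * s powr -\<beta> * (\<Sum>i\<in>K. c i / (r i + s))) \<partial>lborel) =
    ennreal (C * (\<Sum>i\<in>K. c i * r i powr -\<beta>))"
proof -
  have "(\<integral>\<^sup>+ s. ennreal (indicator {0<..} s * s powr -\<beta> * (\<Sum>i\<in>K. c i / (r i + s))) \<partial>lborel) =
      (\<integral>\<^sup>+ s. (\<Sum>i\<in>K. ennreal (c i) * ennreal (indicator {0<..} s * (s powr -\<beta> / (r i + s)))) \<partial>lborel)"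
  proof (intro nn_integral_cong)
    fix s :: real
    define g where "g i = indicator {0<..} s * (s powr -\<beta> / (r i + s))" for i
    have g: "0 \<le> g i" if "i \<in> K" for i
      using r[OF that] by (simp add: indicator_def g_def)
    have "indicator {0<..} s * s powr -\<beta> * (\<Sum>i\<in>K. c i / (r i + s)) = (\<Sum>i\<in>K. c i * g i)"
      by (simp add: sum_distrib_left mult_ac g_def)
    also have "ennreal (\<Sum>i\<in>K. c i * g i) = (\<Sum>i\<in>K. ennreal (c i) * ennreal (g i))"
      using c g by (subst sum_ennreal[symmetric]) (auto simp: ennreal_mult intro!: sum.cong)
    finally show "ennreal (indicator {0<..} s * s powr -\<beta> * (\<Sum>i\<in>K. c i / (r i + s))) =
        (\<Sum>i\<in>K. ennreal (c i) * ennreal (indicator {0<..} s * (s powr -\<beta> / (r i + s))))"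
      by (simp only: g_def)
  qed
  also have "\<dots> = (\<Sum>i\<in>K. ennreal (c i) * ennreal (C * r i powr -\<beta>))"
  proof (subst nn_integral_sum)
    have "(\<integral>\<^sup>+ s. ennreal (c i) * ennreal (indicator {0<..} s * (s powr -\<beta> / (r i + s))) \<partial>lborel) =
        ennreal (c i) * ennreal (C * r i powr -\<beta>)" if "i \<in> K" for i
      unfolding C[OF r[OF that], symmetric] by (rule nn_integral_cmult) measurable
    then show "(\<Sum>i\<in>K. \<integral>\<^sup>+ s. ennreal (c i) * ennreal (indicator {0<..} s * (s powr -\<beta> / (r i + s))) \<partial>lborel) =
        (\<Sum>i\<in>K. ennreal (c i) * ennreal (C * r i powr -\<beta>))"
      by (rule sum.cong[OF refl])
  qed measurable
  also have "\<dots> = ennreal (C * (\<Sum>i\<in>K. c i * r i powr -\<beta>))"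
    using c C0 by (simp add: sum_ennreal sum_distrib_left mult_ac flip: ennreal_mult)
  finally show ?thesis .
qed

text \<open>Negative powers are positive mixtures of resolvents, so an inequality between all
  resolvent forms can be integrated. Here \<open>t\<close> and \<open>u\<close> stand for the
  spectra of two operators and \<open>a\<close> and \<open>b\<close> for squared overlaps; the two
  index sets differ because one side will also run over blocks.\<close>

lemma sum_powr_le_of_resolvents:
  fixes a t :: "'i \<Rightarrow> real" and b u :: "'j \<Rightarrow> real"
  assumes \<beta>: "0 < \<beta>" "\<beta> < 1"
    and fin: "finite I" "finite J"
    and t: "\<And>i. i \<in> I \<Longrightarrow> 0 < t i" and a: "\<And>i. i \<in> I \<Longrightarrow> 0 \<le> a i"
    and u: "\<And>j. j \<in> J \<Longrightarrow> 0 < u j" and b: "\<And>j. j \<in> J \<Longrightarrow> 0 \<le> b j"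
    and le: "\<And>s. 0 < s \<Longrightarrow> (\<Sum>i\<in>I. a i / (t i + s)) \<le> (\<Sum>j\<in>J. b j / (u j + s))"
  shows "(\<Sum>i\<in>I. a i * t i powr -\<beta>) \<le> (\<Sum>j\<in>J. b j * u j powr -\<beta>)"
proof -
  obtain C :: real where C: "0 < C"
    "\<And>t. 0 < t \<Longrightarrow> (\<integral>\<^sup>+ s. ennreal (indicator {0<..} s * (s powr -\<beta> / (t + s))) \<partial>lborel) =
      ennreal (C * t powr -\<beta>)"
    by (rule nn_integral_resolvent[OF \<beta>]) blast
  have intI: "(\<integral>\<^sup>+ s. ennreal (indicator {0<..} s * s powr -\<beta> * (\<Sum>i\<in>I. a i / (t i + s))) \<partial>lborel) =
      ennreal (C * (\<Sum>i\<in>I. a i * t i powr -\<beta>))"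
    by (rule nn_integral_sum_resolvent[OF C(2) C(1)]) (use fin t a in auto)
  have intJ: "(\<integral>\<^sup>+ s. ennreal (indicator {0<..} s * s powr -\<beta> * (\<Sum>j\<in>J. b j / (u j + s))) \<partial>lborel) =
      ennreal (C * (\<Sum>j\<in>J. b j * u j powr -\<beta>))"
    by (rule nn_integral_sum_resolvent[OF C(2) C(1)]) (use fin u b in auto)
  have "ennreal (C * (\<Sum>i\<in>I. a i * t i powr -\<beta>)) \<le> ennreal (C * (\<Sum>j\<in>J. b j * u j powr -\<beta>))"
    unfolding intI[symmetric] intJ[symmetric]
    using le by (intro nn_integral_mono ennreal_leI) (auto simp: indicator_def mult_left_mono)
  then have "C * (\<Sum>i\<in>I. a i * t i powr -\<beta>) \<le> C * (\<Sum>j\<in>J. b j * u j powr -\<beta>)"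
  proof (rule iffD1[OF ennreal_le_iff, rotated])
    show "0 \<le> C * (\<Sum>j\<in>J. b j * u j powr -\<beta>)"
      using C(1) b by (intro mult_nonneg_nonneg sum_nonneg) auto
  qed
  then show ?thesis using C(1) by simp
qed

section \<open>Pinching\<close>

text \<open>Blocks are given by a labelling \<open>f\<close> of the basis.\<close>

definition block_proj :: "('i \<Rightarrow> 'c) \<Rightarrow> 'c \<Rightarrow> ('i::finite) operator" where
  "block_proj f c = diag_op (\<lambda>i. if f i = c then 1 else 0)"

text \<open>Entrywise form of the sum of \<open>P c ** A ** P c\<close> over the block projections
  \<open>P c\<close>.\<close>

definition pinch :: "('i \<Rightarrow> 'c) \<Rightarrow> ('i::finite) operator \<Rightarrow> 'i operator" where
  "pinch f A = (\<chi> i j. if f i = f j then A $ i $ j else 0)"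

definition block_diagonal :: "('i \<Rightarrow> 'c) \<Rightarrow> ('i::finite) operator \<Rightarrow> bool" where
  "block_diagonal f A \<longleftrightarrow> (\<forall>i j. f i \<noteq> f j \<longrightarrow> A $ i $ j = 0)"

lemma block_proj_vec: "(block_proj f c *v x) $ i = (if f i = c then x $ i else 0)"
  by (simp add: block_proj_def diag_op_mult_vec)

lemma adjoint_block_proj [simp]: "adjoint_op (block_proj f c) = block_proj f c"
  by (simp add: block_proj_def)

lemma block_proj_idem: "block_proj f c *v (block_proj f c *v x) = block_proj f c *v x"
  by (simp add: vec_eq_iff block_proj_vec)

text \<open>Phrased as commutation, the property passes to powers by
  \<open>op_powr_commute\<close>.\<close>

lemma block_diagonal_iff_commute:
  "block_diagonal f A \<longleftrightarrow> (\<forall>c. A ** block_proj f c = block_proj f c ** A)"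
proof -
  have "(\<forall>c. A ** block_proj f c = block_proj f c ** A) \<longleftrightarrow>
      (\<forall>c i j. A $ i $ j * (if f j = c then 1 else 0) = (if f i = c then 1 else 0) * A $ i $ j)"
    unfolding block_proj_def vec_eq_iff diag_op_mult_left diag_op_mult_right
    by (simp add: if_distrib[of complex_of_real] cong: if_cong)
  then show ?thesis unfolding block_diagonal_def by (auto split: if_splits)
qed

lemma block_diagonal_pinch: "block_diagonal f (pinch f A)"
  by (simp add: block_diagonal_def pinch_def)

lemma block_diagonal_op_powr:
  assumes "positive_op A" "block_diagonal f A"
  shows "block_diagonal f (op_powr A s)"
  using assms op_powr_commute unfolding block_diagonal_iff_commute by blast

lemma cinner_block_proj:
  "cinner x (block_proj f c *v y) = cinner (block_proj f c *v x) (block_proj f c *v y)"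
  by (metis adjoint_block_proj block_proj_idem cinner_adjoint_op)

lemma sum_cinner_block_proj:
  fixes f :: "'i::finite \<Rightarrow> 'c::finite"
  shows "(\<Sum>c\<in>UNIV. cinner (block_proj f c *v x) (block_proj f c *v y)) = cinner x y"
proof -
  have "(\<Sum>c\<in>UNIV. block_proj f c *v y) = y"
    by (simp add: vec_eq_iff block_proj_vec)
  then show ?thesis by (simp flip: cinner_block_proj cinner_sum_right)
qed

lemma sum_norm_block_proj:
  fixes f :: "'i::finite \<Rightarrow> 'c::finite"
  shows "(\<Sum>c\<in>UNIV. (norm (block_proj f c *v x))\<^sup>2) = (norm x)\<^sup>2"
proof -
  have "complex_of_real (\<Sum>c\<in>UNIV. (norm (block_proj f c *v x))\<^sup>2) = complex_of_real ((norm x)\<^sup>2)"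
    unfolding of_real_sum cinner_self[symmetric] by (rule sum_cinner_block_proj)
  then show ?thesis by (simp only: of_real_eq_iff)
qed

lemma cinner_pinch:
  fixes f :: "'i::finite \<Rightarrow> 'c::finite"
  shows "cinner x (pinch f A *v y) =
    (\<Sum>c\<in>UNIV. cinner (block_proj f c *v x) (A *v (block_proj f c *v y)))"
proof -
  have "pinch f A *v y = (\<Sum>c\<in>UNIV. block_proj f c *v (A *v (block_proj f c *v y)))"
    by (simp add: vec_eq_iff block_proj_vec)
      (simp add: matrix_vector_mult_def pinch_def block_proj_vec[unfolded matrix_vector_mult_def, simplified]
        if_distrib[of "\<lambda>z. z * _"] if_distrib[of "\<lambda>z. _ * z"] eq_commute cong: if_cong)
  then show ?thesis
    by (simp add: cinner_sum_right cinner_adjoint_op[of _ "block_proj f _"])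
qed

lemma positive_op_pinch:
  fixes f :: "'i::finite \<Rightarrow> 'c::finite"
  assumes "positive_op A"
  shows "positive_op (pinch f A)"
proof -
  have "adjoint_op (pinch f A) $ i $ j = pinch f A $ i $ j" for i j
  proof -
    have "adjoint_op A $ i $ j = A $ i $ j" using assms by (simp add: positive_op_def)
    then show ?thesis by (auto simp: pinch_def adjoint_op_def)
  qed
  then show ?thesis
    using assms by (auto simp: positive_op_def vec_eq_iff cinner_pinch intro!: sum_nonneg)
qed

lemma state_pinch:
  fixes f :: "'i::finite \<Rightarrow> 'c::finite"
  assumes "state A"
  shows "state (pinch f A)"
  using assms positive_op_pinch[of A f] by (auto simp: state_def trace_def pinch_def)

text \<open>The form is the squared norm of the square root of \<open>A\<close> applied to
  \<open>x\<close>.\<close>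

lemma positive_op_form_eq_zero:
  assumes "positive_op A" "Re (cinner x (A *v x)) = 0"
  shows "A *v x = 0"
proof -
  let ?S = "op_powr A (1/2)"
  have S: "adjoint_op ?S = ?S" by (rule adjoint_op_powr[OF assms(1)])
  have SS: "?S ** ?S = A" by (simp add: op_powr_mult op_powr_one assms(1))
  have "cinner x (A *v x) = cinner (?S *v x) (?S *v x)"
    using S by (simp add: cinner_adjoint_op_left matrix_vector_mul_assoc SS)
  then have "?S *v x = 0" using assms(2) by (simp add: cinner_self)
  then show ?thesis by (metis SS matrix_vector_mul_assoc matrix_vector_mult_0_right)
qed

text \<open>The form of the pinched operator is a sum of nonnegative forms of \<open>A\<close>, one
  per block, so each of them vanishes. Dually, pinching can only enlarge the support.\<close>

lemma pinch_kernel: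
  fixes f :: "'i::finite \<Rightarrow> 'c::finite"
  assumes A: "positive_op A" and "pinch f A *v x = 0"
  shows "A *v (block_proj f c *v x) = 0" "A *v x = 0"
proof -
  have "(\<Sum>c\<in>UNIV. Re (cinner (block_proj f c *v x) (A *v (block_proj f c *v x)))) = 0"
    using assms(2) by (simp flip: Re_sum cinner_pinch)
  then show 0: "A *v (block_proj f c *v x) = 0" for c
    using A by (subst (asm) sum_nonneg_eq_0_iff) (auto simp: positive_op_def intro!: positive_op_form_eq_zero[OF A])
  have "x = (\<Sum>c\<in>UNIV. block_proj f c *v x)"
    by (simp add: vec_eq_iff block_proj_vec)
  also have "A *v \<dots> = (\<Sum>c\<in>UNIV. A *v (block_proj f c *v x))"
    by (rule vec.linear_sum[OF matrix_vector_mul_linear_gen])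
  finally show "A *v x = 0" by (simp add: 0)
qed

lemma supp_pinch:
  fixes f :: "'i::finite \<Rightarrow> 'c::finite"
  assumes "positive_op A"
  shows "supp A \<subseteq> supp (pinch f A)"
  using pinch_kernel(2)[OF assms] by (auto simp: supp_def)

section \<open>Jensen's operator inequality for pinchings\<close>

lemma parseval_cinner:
  fixes x y :: "complex ^ 'a::finite"
  assumes "unitary U"
  shows "cinner x y = (\<Sum>i\<in>UNIV. cnj (cinner (column i U) x) * cinner (column i U) y)"
proof -
  have "diag_op (\<lambda>_::'a. 1) = mat 1" by (simp add: diag_op_def mat_def vec_eq_iff)
  then show ?thesis
    using spectral_form[of x U "\<lambda>_. 1" y] assms by (simp add: unitary_cancel)
qed

text \<open>The left side is largest at \<open>a = b / m\<close>. For an eigenvalue \<open>m\<close>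
  this is one coordinate of the variational formula for the inverse.\<close>

lemma two_Re_le:
  fixes a b :: complex
  assumes "0 < m"
  shows "2 * Re (cnj a * b) - m * (cmod a)\<^sup>2 \<le> (cmod b)\<^sup>2 / m"
proof -
  have "Re (cnj a * b) \<le> cmod a * cmod b"
    using complex_Re_le_cmod[of "cnj a * b"] by (simp add: norm_mult)
  moreover have "0 \<le> (m * cmod a - cmod b)\<^sup>2" by simp
  then have "2 * (cmod a * cmod b) * m \<le> m * (m * (cmod a)\<^sup>2) + (cmod b)\<^sup>2"
    by (simp add: power2_eq_square algebra_simps)
  then have "2 * (cmod a * cmod b) \<le> m * (cmod a)\<^sup>2 + (cmod b)\<^sup>2 / m"
    using assms by (simp add: field_simps)
  ultimately show ?thesis by linarith
qed

text \<open>
  The quadratic form of the inverse of a positive definite \<open>B\<close> is the maximum over \<open>z\<close> of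
  \<open>2 Re \<langle>z, x\<rangle> - \<langle>z, B z\<rangle>\<close>. For the pinched operator, the objective is the sum of the
  objectives of the blocks, and a sum of maxima dominates the maximum of the sum.
\<close>

lemma resolvent_pinch_le:
  fixes f :: "'i::finite \<Rightarrow> 'c::finite"
  assumes U: "unitary U" and d: "\<And>i. 0 \<le> d i" and A: "A = U ** diag_op d ** adjoint_op U"
    and W: "unitary W" and e: "\<And>i. 0 \<le> e i" and B: "pinch f A = W ** diag_op e ** adjoint_op W"
    and s: "0 < s"
  shows "(\<Sum>j\<in>UNIV. (cmod (cinner (column j W) x))\<^sup>2 / (e j + s)) \<le>
    (\<Sum>c\<in>UNIV. \<Sum>i\<in>UNIV. (cmod (cinner (column i U) (block_proj f c *v x)))\<^sup>2 / (d i + s))"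
    (is "?L \<le> _")
proof -
  \<comment> \<open>The maximizer for the pinched operator: \<open>pinch f A\<close> plus
    \<open>s\<close> times the identity, inverted in its eigenbasis and applied to
    \<open>x\<close>.\<close>
  define z where "z = W *v (\<chi> j. cinner (column j W) x / complex_of_real (e j + s))"
  have wz: "cinner (column j W) z = cinner (column j W) x / complex_of_real (e j + s)" for j
  proof -
    have "cinner (column j W) z = (adjoint_op W *v z) $ j" by (simp add: adjoint_mult_vec_nth)
    also have "\<dots> = cinner (column j W) x / complex_of_real (e j + s)"
      by (simp add: z_def matrix_vector_mul_assoc unitary_cancel[OF W])
    finally show ?thesis .
  qed
  have es: "0 < e j + s" for j using e[of j] s by simp
  have "Re (cinner z x) = ?L"
  proof -
    have "cnj (cinner (column j W) z) * cinner (column j W) x =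
        complex_of_real ((cmod (cinner (column j W) x))\<^sup>2 / (e j + s))" for j
      by (simp add: wz complex_norm_square mult.commute del: of_real_power of_real_add)
    then show ?thesis by (simp add: parseval_cinner[OF W, of z x] del: of_real_divide)
  qed
  moreover have "Re (cinner z (pinch f A *v z)) + s * (norm z)\<^sup>2 = ?L"
  proof -
    have "Re (cinner z (pinch f A *v z)) + s * (norm z)\<^sup>2 =
        (\<Sum>j\<in>UNIV. (e j + s) * (cmod (cinner (column j W) z))\<^sup>2)"
      unfolding B spectral_quadratic_form parseval[OF W, of z, symmetric]
      by (simp add: sum_distrib_left distrib_right sum.distrib)
    also have "\<dots> = ?L"
    proof (intro sum.cong refl)
      fix j
      have "cmod (complex_of_real (e j + s)) = e j + s" using es[of j] by (simp only: norm_of_real abs_of_pos)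
      then show "(e j + s) * (cmod (cinner (column j W) z))\<^sup>2 = (cmod (cinner (column j W) x))\<^sup>2 / (e j + s)"
        using es[of j] unfolding wz norm_divide by (simp add: power2_eq_square)
    qed
    finally show ?thesis .
  qed
  \<comment> \<open>At the maximizer the linear and the quadratic term both equal \<open>?L\<close>,
    so the objective is \<open>2 * ?L - ?L\<close>. From here on it is only split into blocks and
    bounded in each block.\<close>
  ultimately have "?L = 2 * Re (cinner z x) - (Re (cinner z (pinch f A *v z)) + s * (norm z)\<^sup>2)"
    by simp
  also have "\<dots> = (\<Sum>c\<in>UNIV. 2 * Re (cinner (block_proj f c *v z) (block_proj f c *v x)) -
      (Re (cinner (block_proj f c *v z) (A *v (block_proj f c *v z))) + s * (norm (block_proj f c *v z))\<^sup>2))"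
    unfolding cinner_pinch sum_cinner_block_proj[of f z x, symmetric] sum_norm_block_proj[of f z, symmetric]
    by (simp add: sum_subtractf sum.distrib sum_distrib_left)
  also have "\<dots> \<le> (\<Sum>c\<in>UNIV. \<Sum>i\<in>UNIV. (cmod (cinner (column i U) (block_proj f c *v x)))\<^sup>2 / (d i + s))"
  proof (intro sum_mono)
    fix c
    let ?a = "\<lambda>i. cinner (column i U) (block_proj f c *v z)"
    let ?b = "\<lambda>i. cinner (column i U) (block_proj f c *v x)"
    have "2 * Re (cinner (block_proj f c *v z) (block_proj f c *v x)) -
        (Re (cinner (block_proj f c *v z) (A *v (block_proj f c *v z))) + s * (norm (block_proj f c *v z))\<^sup>2) =
        (\<Sum>i\<in>UNIV. 2 * Re (cnj (?a i) * ?b i) - (d i + s) * (cmod (?a i))\<^sup>2)"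
      unfolding A spectral_quadratic_form parseval[OF U, symmetric]
        parseval_cinner[OF U, of "block_proj f c *v z" "block_proj f c *v x"] Re_sum
      by (simp add: sum_subtractf sum.distrib sum_distrib_left distrib_right del: times_complex.sel)
    also have "\<dots> \<le> (\<Sum>i\<in>UNIV. (cmod (?b i))\<^sup>2 / (d i + s))"
      using d s by (intro sum_mono two_Re_le add_nonneg_pos)
    finally show "2 * Re (cinner (block_proj f c *v z) (block_proj f c *v x)) -
        (Re (cinner (block_proj f c *v z) (A *v (block_proj f c *v z))) + s * (norm (block_proj f c *v z))\<^sup>2) \<le>
        (\<Sum>i\<in>UNIV. (cmod (?b i))\<^sup>2 / (d i + s))" .
  qed
  finally show ?thesis .
qed

lemma op_powr_pinch_le:
  fixes f :: "'i::finite \<Rightarrow> 'c::finite"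
  assumes A: "positive_op A" and \<beta>: "0 < \<beta>" "\<beta> < 1"
    and x: "\<And>c. block_proj f c *v x \<in> supp A"
  shows "Re (cinner x (op_powr (pinch f A) (-\<beta>) *v x)) \<le>
    (\<Sum>c\<in>UNIV. Re (cinner (block_proj f c *v x) (op_powr A (-\<beta>) *v (block_proj f c *v x))))"
proof -
  obtain U d where U: "unitary U" and d: "\<And>i. 0 \<le> d i"
    and dA: "A = U ** diag_op d ** adjoint_op U"
    and P: "\<And>s. op_powr A s = U ** diag_op (\<lambda>i. d i powr s) ** adjoint_op U"
    by (rule op_powr_spectral[OF A]) blast
  obtain W e where W: "unitary W" and e: "\<And>i. 0 \<le> e i"
    and dB: "pinch f A = W ** diag_op e ** adjoint_op W"
    and Q: "\<And>s. op_powr (pinch f A) s = W ** diag_op (\<lambda>i. e i powr s) ** adjoint_op W"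
    by (rule op_powr_spectral[OF positive_op_pinch[OF A, of f]]) blast
  define a where "a j = (cmod (cinner (column j W) x))\<^sup>2" for j
  define b where "b = (\<lambda>(c, i). (cmod (cinner (column i U) (block_proj f c *v x)))\<^sup>2)"
  \<comment> \<open>At a zero eigenvalue of \<open>A\<close> the resolvent contributes
    \<open>1 / s\<close>, but the negative power contributes 0. The support hypothesis removes these
    terms from the upper bound; those of the pinched operator are nonnegative and may be dropped
    from the lower side.\<close>
  have b0: "b (c, i) = 0" if "d i = 0" for c i
    using supp_orthogonal[OF U dA x that] by (simp add: b_def)
  have "(\<Sum>j\<in>{j. 0 < e j}. a j * e j powr -\<beta>) \<le> (\<Sum>p\<in>{p. 0 < d (snd p)}. b p * d (snd p) powr -\<beta>)"
  proof (rule sum_powr_le_of_resolvents[OF \<beta>])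
    fix s :: real
    assume s: "0 < s"
    have "(\<Sum>j\<in>{j. 0 < e j}. a j / (e j + s)) \<le> (\<Sum>j\<in>UNIV. a j / (e j + s))"
      using e s by (intro sum_mono2) (auto simp: a_def add_nonneg_nonneg)
    also have "\<dots> \<le> (\<Sum>c\<in>UNIV. \<Sum>i\<in>UNIV. b (c, i) / (d i + s))"
      using resolvent_pinch_le[OF U d dA W e dB s, of x] by (simp add: a_def b_def)
    also have "\<dots> = (\<Sum>p\<in>UNIV. b p / (d (snd p) + s))"
      by (simp add: sum.cartesian_product case_prod_unfold)
    also have "\<dots> = (\<Sum>p\<in>{p. 0 < d (snd p)}. b p / (d (snd p) + s))"
      using b0 d by (intro sum.mono_neutral_right) (auto simp: less_le)
    finally show "(\<Sum>j\<in>{j. 0 < e j}. a j / (e j + s)) \<le> (\<Sum>p\<in>{p. 0 < d (snd p)}. b p / (d (snd p) + s))" .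
  qed (auto simp: a_def b_def)
  also have "(\<Sum>j\<in>{j. 0 < e j}. a j * e j powr -\<beta>) = (\<Sum>j\<in>UNIV. e j powr -\<beta> * a j)"
    using e by (intro sum.mono_neutral_cong_left) (auto simp: less_le)
  also have "(\<Sum>p\<in>{p. 0 < d (snd p)}. b p * d (snd p) powr -\<beta>) = (\<Sum>p\<in>UNIV. d (snd p) powr -\<beta> * b p)"
    using d by (intro sum.mono_neutral_cong_left) (auto simp: less_le)
  also have "\<dots> = (\<Sum>c\<in>UNIV. \<Sum>i\<in>UNIV. d i powr -\<beta> * b (c, i))"
    by (simp add: sum.cartesian_product case_prod_unfold)
  finally show ?thesis
    unfolding P Q spectral_quadratic_form by (simp add: a_def b_def)
qed

section \<open>A pinching inequality for traces of powers\<close>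

text \<open>Young's inequality for the conjugate exponents \<alpha> and \<alpha> / (\<alpha> -
  1).\<close>

lemma mult_powr_le:
  fixes x y \<alpha> :: real
  assumes "1 < \<alpha>" "0 \<le> x" "0 \<le> y"
  shows "x * y powr (\<alpha> - 1) \<le> x powr \<alpha> / \<alpha> + (1 - 1 / \<alpha>) * y powr \<alpha>"
proof -
  have "x * y powr (\<alpha> - 1) \<le> x powr \<alpha> / \<alpha> + y powr ((\<alpha> - 1) * (\<alpha> / (\<alpha> - 1))) / (\<alpha> / (\<alpha> - 1))"
    unfolding powr_powr[symmetric]
    using assms by (intro Youngs_inequality) (auto simp: field_simps)
  also have "(\<alpha> - 1) * (\<alpha> / (\<alpha> - 1)) = \<alpha>" using assms by simp
  finally show ?thesis using assms by (simp add: diff_divide_distrib algebra_simps)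
qed

text \<open>
  The matrix \<open>p\<close> of overlaps between the eigenbasis of \<open>G\<close> and the blocks of the eigenbasis of \<open>H\<close>
  is doubly stochastic.
\<close>

lemma trace_op_powr_le_pinch:
  fixes f :: "'i::finite \<Rightarrow> 'c::finite"
  assumes G: "positive_op G" and H: "positive_op H" and \<alpha>: "1 < \<alpha>"
    and le: "\<And>x. Re (cinner x (H *v x)) \<le>
      (\<Sum>c\<in>UNIV. Re (cinner (block_proj f c *v x) (G *v (block_proj f c *v x))))"
  shows "Re (trace (op_powr H \<alpha>)) \<le> Re (trace (op_powr G \<alpha>))"
proof -
  obtain U g where U: "unitary U" and g: "\<And>i. 0 \<le> g i" and dG: "G = U ** diag_op g ** adjoint_op U"
    by (rule spectral_decomposition[OF G]) blast
  obtain W e where W: "unitary W" and e: "\<And>i. 0 \<le> e i" and dH: "H = W ** diag_op e ** adjoint_op W"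
    by (rule spectral_decomposition[OF H]) blast
  define p where "p i j = (\<Sum>c\<in>UNIV. (cmod (cinner (column i U) (block_proj f c *v column j W)))\<^sup>2)" for i j
  have p0: "0 \<le> p i j" for i j by (simp add: p_def sum_nonneg)
  have norm_col: "norm (column i V) = 1" if "unitary V" for i and V :: "'i operator"
    using cinner_self[of "column i V"] unitary_columns[OF that, of i i]
    by (simp add: power2_eq_1_iff flip: of_real_power) (smt (verit) norm_ge_zero)
  have p1: "(\<Sum>i\<in>UNIV. p i j) = 1" for j
    unfolding p_def by (subst sum.swap) (simp add: parseval[OF U] sum_norm_block_proj norm_col[OF W])
  have p2: "(\<Sum>j\<in>UNIV. p i j) = 1" for i
  proof -
    \<comment> \<open>Block projections are self-adjoint, so \<open>U\<close> and \<open>W\<close>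
      can exchange roles and the row sums follow from Parseval for \<open>W\<close>.\<close>
    have "cmod (cinner (column i U) (block_proj f c *v column j W)) =
        cmod (cinner (column j W) (block_proj f c *v column i U))" for c j
      by (metis adjoint_block_proj cinner_adjoint_op cinner_commute complex_mod_cnj)
    then show ?thesis
      unfolding p_def by (subst sum.swap) (simp add: parseval[OF W] sum_norm_block_proj norm_col[OF U])
  qed
  have e_le: "e j \<le> (\<Sum>i\<in>UNIV. p i j * g i)" for j
  proof -
    have "e j = Re (cinner (column j W) (H *v column j W))"
      by (simp add: spectral_mult_column[OF W dH] cinner_scale_right unitary_columns[OF W])
    also have "\<dots> \<le> (\<Sum>c\<in>UNIV. \<Sum>i\<in>UNIV. g i * (cmod (cinner (column i U) (block_proj f c *v column j W)))\<^sup>2)"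
      using le[of "column j W"] unfolding dG spectral_quadratic_form .
    also have "\<dots> = (\<Sum>i\<in>UNIV. p i j * g i)"
      by (subst sum.swap) (simp add: p_def sum_distrib_left mult.commute)
    finally show ?thesis .
  qed
  let ?E = "\<Sum>j\<in>UNIV. e j powr \<alpha>" and ?G = "\<Sum>i\<in>UNIV. g i powr \<alpha>"
  have "?E = (\<Sum>j\<in>UNIV. e j * e j powr (\<alpha> - 1))"
    using e powr_add[of "e _" 1 "\<alpha> - 1"] by simp
  also have "\<dots> \<le> (\<Sum>j\<in>UNIV. \<Sum>i\<in>UNIV. p i j * (g i * e j powr (\<alpha> - 1)))"
    using e_le by (intro sum_mono) (simp add: mult_right_mono flip: sum_distrib_right mult.assoc)
  also have "\<dots> \<le> (\<Sum>j\<in>UNIV. \<Sum>i\<in>UNIV. p i j * (g i powr \<alpha> / \<alpha> + (1 - 1 / \<alpha>) * e j powr \<alpha>))"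
    using \<alpha> e g p0 by (intro sum_mono mult_left_mono mult_powr_le)
  also have "\<dots> = (\<Sum>i\<in>UNIV. \<Sum>j\<in>UNIV. p i j * (g i powr \<alpha> / \<alpha>)) +
      (\<Sum>j\<in>UNIV. \<Sum>i\<in>UNIV. p i j * ((1 - 1 / \<alpha>) * e j powr \<alpha>))"
    by (subst (2) sum.swap) (simp only: distrib_left sum.distrib)
  also have "\<dots> = ?G / \<alpha> + (1 - 1 / \<alpha>) * ?E"
    by (simp only: sum_distrib_right[symmetric] p1 p2 mult_1 sum_divide_distrib sum_distrib_left)
  \<comment> \<open>The unit row and column sums have removed \<open>p\<close>; the right side
    contains only the fraction \<open>1 - 1 / \<alpha>\<close> of \<open>?E\<close>, which is
    absorbed on the left.\<close>
  finally have "?E / \<alpha> \<le> ?G / \<alpha>" by (simp add: algebra_simps)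
  then have "?E \<le> ?G" using \<alpha> by (simp add: divide_le_cancel)
  then show ?thesis
    by (simp add: trace_op_powr[OF U g dG] trace_op_powr[OF W e dH])
qed

text \<open>Some eigenvalue is nonzero, and its power is positive. This makes the monotonicity of
  the logarithm available for comparing entropies.\<close>

lemma trace_op_powr_pos:
  assumes "positive_op A" "A \<noteq> 0"
  shows "0 < Re (trace (op_powr A s))"
proof -
  obtain U d where U: "unitary U" and d: "\<And>i. 0 \<le> d i" and A: "A = U ** diag_op d ** adjoint_op U"
    by (rule spectral_decomposition[OF assms(1)]) blast
  have "\<exists>i. d i \<noteq> 0"
  proof (rule ccontr)
    assume "\<not> (\<exists>i. d i \<noteq> 0)"
    then have "diag_op d = 0" by (simp add: diag_op_def vec_eq_iff)
    then show False using assms(2) A by simp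
  qed
  then obtain i where "d i \<noteq> 0" ..
  then have "0 < (\<Sum>i\<in>UNIV. d i powr s)"
    by (intro sum_pos2[of UNIV i]) auto
  then show ?thesis by (simp add: trace_op_powr[OF U d A])
qed

section \<open>The conditional entropy through Gram operators\<close>

text \<open>The component of a bipartite vector at a basis label of the first register. An operator
  \<open>tensor_op (mat 1) T\<close> acts on every slice as \<open>T\<close>, which reduces
  bipartite statements to the conditioning register.\<close>

definition slice :: "'a::finite \<Rightarrow> complex ^ ('a \<times> 'b::finite) \<Rightarrow> complex ^ 'b" where
  "slice a x = (\<chi> b. x $ (a, b))"

lemma slice_nth [simp]: "slice a x $ b = x $ (a, b)"
  by (simp add: slice_def)

lemma slice_add: "slice a (x + y) = slice a x + slice a y"
  and slice_scale: "slice a (c *s x) = c *s slice a x"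
  and slice_zero: "slice a 0 = 0"
  by (simp_all add: vec_eq_iff)

lemma eq_zero_of_slices: "(\<And>a. slice a x = 0) \<Longrightarrow> x = 0"
  by (simp add: vec_eq_iff)

lemma sum_prod_UNIV: "(\<Sum>i\<in>UNIV. g i) = (\<Sum>a\<in>UNIV. \<Sum>b\<in>UNIV. g (a, b))"
  for g :: "'a::finite \<times> 'b::finite \<Rightarrow> 'm::comm_monoid_add"
  by (simp add: sum.cartesian_product)

lemma cinner_slices: "cinner x y = (\<Sum>a\<in>UNIV. cinner (slice a x) (slice a y))"
  for x y :: "complex ^ ('a::finite \<times> 'b::finite)"
  by (simp add: cinner_def sum_prod_UNIV)

lemma slice_tensor_one: "slice a (tensor_op (mat 1) T *v x) = T *v slice a x"
  for T :: "complex ^ 'b::finite ^ 'd" and x :: "complex ^ ('a::finite \<times> 'b)"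
  by (simp add: vec_eq_iff matrix_vector_mult_def tensor_op_def sum_prod_UNIV mat_def
      if_distrib[of "\<lambda>z. z * _"] cong: if_cong) (intro allI, subst sum.swap, simp)

lemma tensor_one_mult:
  fixes S :: "complex ^ 'b::finite ^ 'd::finite" and T :: "complex ^ 'c::finite ^ 'b"
  shows "tensor_op (mat 1 :: 'a::finite operator) S ** tensor_op (mat 1) T = tensor_op (mat 1) (S ** T)"
proof -
  have "slice a ((tensor_op (mat 1 :: 'a operator) S ** tensor_op (mat 1) T) *v x) =
      slice a (tensor_op (mat 1) (S ** T) *v x)" for a x
    by (simp add: slice_tensor_one flip: matrix_vector_mul_assoc)
  then show ?thesis
    unfolding matrix_eq vec_eq_iff slice_def vec_lambda_beta by auto
qed

lemma adjoint_tensor_one: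
  "adjoint_op (tensor_op (mat 1 :: 'a::finite operator) T) = tensor_op (mat 1) (adjoint_op T)"
  by (simp add: adjoint_op_def tensor_op_def vec_eq_iff mat_def)

text \<open>Vectors with all slices in \<open>S\<close> form a subspace containing the generators;
  conversely \<open>x\<close> is the sum of the products of \<open>axis a 1\<close> with its
  slices.\<close>

lemma mem_full_tensor_iff:
  fixes x :: "complex ^ ('a::finite \<times> 'b::finite)"
  assumes S: "vec.subspace S"
  shows "x \<in> full_tensor S \<longleftrightarrow> (\<forall>a. slice a x \<in> S)"
proof
  have "full_tensor S \<subseteq> {x :: complex ^ ('a \<times> 'b). \<forall>a. slice a x \<in> S}"
    unfolding full_tensor_def
  proof (rule vec.span_minimal)
    have "slice a (tensor_vec x y) = x $ a *s y" for a and x :: "complex ^ 'a" and y :: "complex ^ 'b"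
      by (simp add: vec_eq_iff tensor_vec_def)
    then show "{tensor_vec x y | x y. y \<in> S} \<subseteq> {x :: complex ^ ('a \<times> 'b). \<forall>a. slice a x \<in> S}"
      using vec.subspace_scale[OF S] by auto
    show "vec.subspace {x :: complex ^ ('a \<times> 'b). \<forall>a. slice a x \<in> S}"
      using S by (simp add: vec.subspace_def slice_add slice_scale slice_zero)
  qed
  then show "\<forall>a. slice a x \<in> S" if "x \<in> full_tensor S" using that by blast
next
  assume "\<forall>a. slice a x \<in> S"
  then have "tensor_vec (axis a 1) (slice a x) \<in> full_tensor S" for a
    unfolding full_tensor_def by (intro vec.span_base) blast
  then have "(\<Sum>a\<in>UNIV. tensor_vec (axis a 1) (slice a x)) \<in> full_tensor S"
    unfolding full_tensor_def by (intro vec.span_sum)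
  moreover have "(\<Sum>a\<in>UNIV. tensor_vec (axis a 1) (slice a x)) = x"
    by (simp add: vec_eq_iff tensor_vec_def axis_def if_distrib[of "\<lambda>z. z * _"] cong: if_cong)
  ultimately show "x \<in> full_tensor S" by simp
qed

text \<open>Pairing \<open>z\<close> with the product of \<open>axis a 1\<close> and
  \<open>v\<close> gives \<open>cinner v (slice a z)\<close>. For \<open>v\<close> in the kernel of
  \<sigma>, both sides thus say that these products lie in the kernel of
  \<open>adjoint_op K\<close>, which is also the kernel of \<open>K ** adjoint_op K\<close>.\<close>

lemma supp_subset_full_tensor_iff:
  fixes K :: "complex ^ 'k::finite ^ ('a::finite \<times> 'b::finite)"
  shows "supp (K ** adjoint_op K) \<subseteq> full_tensor (supp \<sigma>) \<longleftrightarrow> (\<forall>y a. slice a (K *v y) \<in> supp \<sigma>)"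
proof
  assume *: "supp (K ** adjoint_op K) \<subseteq> full_tensor (supp \<sigma>)"
  have "cinner v (K *v y) = 0" if "(K ** adjoint_op K) *v v = 0" for v y
  proof -
    have "cinner (adjoint_op K *v v) (adjoint_op K *v v) = 0"
      using that by (simp add: cinner_adjoint_op_left matrix_vector_mul_assoc)
    then have "adjoint_op K *v v = 0" by (simp only: cinner_eq_zero_iff)
    then show ?thesis by (simp add: cinner_adjoint_op)
  qed
  then have "K *v y \<in> supp (K ** adjoint_op K)" for y by (simp add: supp_def)
  then show "\<forall>y a. slice a (K *v y) \<in> supp \<sigma>"
    using * mem_full_tensor_iff[OF supp_subspace] by blast
next
  assume *: "\<forall>y a. slice a (K *v y) \<in> supp \<sigma>"
  show "supp (K ** adjoint_op K) \<subseteq> full_tensor (supp \<sigma>)"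
  proof
    fix x
    assume x: "x \<in> supp (K ** adjoint_op K)"
    have "cinner v (slice a x) = 0" if v: "\<sigma> *v v = 0" for v a
    proof -
      define w where "w = tensor_vec (axis a 1) v"
      have w: "cinner w z = cinner v (slice a z)" for z
      proof -
        have "slice b w = (if b = a then v else 0)" for b
          by (simp add: vec_eq_iff w_def tensor_vec_def axis_def)
        then show ?thesis
          by (simp add: cinner_slices[of w] if_distrib[of "\<lambda>z. cinner z _"] cong: if_cong)
      qed
      have "cinner (adjoint_op K *v w) (adjoint_op K *v w) = 0"
        using * v by (simp add: cinner_adjoint_op_left[of "adjoint_op K"] w supp_def)
      then have "(K ** adjoint_op K) *v w = 0"
        by (simp flip: matrix_vector_mul_assoc)
      then have "cinner w x = 0" using x by (simp add: supp_def)
      then show ?thesis by (simp add: w)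
    qed
    then have "slice a x \<in> supp \<sigma>" for a by (simp add: supp_def)
    then show "x \<in> full_tensor (supp \<sigma>)"
      by (simp add: mem_full_tensor_iff[OF supp_subspace])
  qed
qed

text \<open>It acts on the domain \<open>'k\<close> of the factor, not on the register of the state.
  States with different first registers but a common \<open>'k\<close> therefore become
  comparable.\<close>

definition cond_gram ::
    "complex ^ 'k::finite ^ ('a::finite \<times> 'b::finite) \<Rightarrow> 'b operator \<Rightarrow> real \<Rightarrow> 'k operator" where
  "cond_gram K \<sigma> s = adjoint_op K ** tensor_op (mat 1) (op_powr \<sigma> s) ** K"

lemma cond_gram_eq:
  fixes K :: "complex ^ 'k::finite ^ ('a::finite \<times> 'b::finite)" and s :: real
  assumes "positive_op \<sigma>"
  defines "T \<equiv> tensor_op (mat 1 :: 'a operator) (op_powr \<sigma> (s / 2))"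
  shows "cond_gram K \<sigma> s = adjoint_op (T ** K) ** (T ** K)"
proof -
  have "op_powr \<sigma> s = op_powr \<sigma> (s / 2) ** op_powr \<sigma> (s / 2)"
    by (simp add: op_powr_mult[OF assms(1)])
  then have "tensor_op (mat 1) (op_powr \<sigma> s) = T ** T"
    by (simp add: T_def tensor_one_mult)
  moreover have "adjoint_op T = T"
    by (simp add: T_def adjoint_tensor_one adjoint_op_powr[OF assms(1)])
  ultimately show ?thesis
    by (simp add: cond_gram_def adjoint_op_mult matrix_mul_assoc)
qed

lemma positive_op_cond_gram: "positive_op \<sigma> \<Longrightarrow> positive_op (cond_gram K \<sigma> s)"
  for K :: "complex ^ 'k::finite ^ ('a::finite \<times> 'b::finite)"
  by (simp only: cond_gram_eq positive_op_gram)

lemma cinner_cond_gram: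
  fixes K :: "complex ^ 'k::finite ^ ('a::finite \<times> 'b::finite)"
  shows "cinner x (cond_gram K \<sigma> s *v y) =
    (\<Sum>a\<in>UNIV. cinner (slice a (K *v x)) (op_powr \<sigma> s *v slice a (K *v y)))"
proof -
  have "cinner x (cond_gram K \<sigma> s *v y) =
      cinner (K *v x) (tensor_op (mat 1) (op_powr \<sigma> s) *v (K *v y))"
    by (simp add: cond_gram_def cinner_adjoint_op_left matrix_vector_mul_assoc matrix_mul_assoc)
  then show ?thesis by (simp add: cinner_slices[of "K *v x"] slice_tensor_one)
qed

text \<open>Exchanging \<open>Y ** adjoint_op Y\<close> for \<open>adjoint_op Y ** Y\<close> with
  \<open>Y = S ** K\<close> brings the two outer powers of \<sigma> together, which doubles the
  exponent to \<open>(1 - \<alpha>) / \<alpha>\<close>.\<close>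

lemma renyi_rel_gram:
  fixes K :: "complex ^ 'k::finite ^ ('a::finite \<times> 'b::finite)"
  assumes \<sigma>: "positive_op \<sigma>"
  shows "renyi_rel \<alpha> (K ** adjoint_op K) \<sigma> =
    (if \<forall>y a. slice a (K *v y) \<in> supp \<sigma>
     then ereal (1 / (1 - \<alpha>) * log 2 (Re (trace (op_powr (cond_gram K \<sigma> ((1 - \<alpha>) / \<alpha>)) \<alpha>))))
     else - \<infinity>)"
proof -
  define S where "S = tensor_op (mat 1 :: 'a operator) (op_powr \<sigma> ((1 - \<alpha>) / (2 * \<alpha>)))"
  have S: "adjoint_op S = S"
    by (simp add: S_def adjoint_tensor_one adjoint_op_powr[OF \<sigma>])
  have "S ** (K ** adjoint_op K) ** S = (S ** K) ** adjoint_op (S ** K)"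
    by (simp add: adjoint_op_mult S matrix_mul_assoc)
  then have "Re (trace (op_powr (S ** (K ** adjoint_op K) ** S) \<alpha>)) =
      Re (trace (op_powr (adjoint_op (S ** K) ** (S ** K)) \<alpha>))"
    by (simp only: trace_op_powr_gram)
  also have "adjoint_op (S ** K) ** (S ** K) = cond_gram K \<sigma> ((1 - \<alpha>) / \<alpha>)"
    by (simp add: cond_gram_eq[OF \<sigma>] S_def mult.commute)
  finally show ?thesis
    unfolding renyi_rel_def supp_subset_full_tensor_iff S_def Let_def by simp
qed

lemma sqrt_gram:
  assumes "positive_op \<rho>"
  shows "op_powr \<rho> (1/2) ** adjoint_op (op_powr \<rho> (1/2)) = \<rho>"
  by (simp add: adjoint_op_powr[OF assms] op_powr_mult[OF assms] op_powr_one[OF assms])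

section \<open>Pinching does not decrease the entropy of a classical state\<close>

lemma slice_block_proj:
  "slice a (block_proj (\<lambda>i. f (snd i)) c *v x) = block_proj f c *v slice a x"
  by (simp add: vec_eq_iff block_proj_vec)

lemma renyi_rel_le_pinch:
  fixes \<rho> :: "('a::finite \<times> 'b::finite) operator" and f :: "'b \<Rightarrow> 'c::finite"
  assumes \<alpha>: "1 < \<alpha>" and \<rho>: "state \<rho>" and cl: "block_diagonal (\<lambda>i. f (snd i)) \<rho>" and \<sigma>: "positive_op \<sigma>"
  shows "renyi_rel \<alpha> \<rho> \<sigma> \<le> renyi_rel \<alpha> \<rho> (pinch f \<sigma>)"
proof -
  let ?P = "block_proj (\<lambda>i :: 'a \<times> 'b. f (snd i))" and ?\<sigma>' = "pinch f \<sigma>"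
  define K where "K = op_powr \<rho> (1/2)"
  define s where "s = (1 - \<alpha>) / \<alpha>"
  have pos: "positive_op \<rho>" and tr: "trace \<rho> = 1" using \<rho> by (auto simp: state_def)
  have \<rho>K: "\<rho> = K ** adjoint_op K" by (simp add: K_def sqrt_gram[OF pos])
  have \<sigma>': "positive_op ?\<sigma>'" by (rule positive_op_pinch[OF \<sigma>])
  \<comment> \<open>This is where classicality enters. The square root is block diagonal together
    with the state, so a block projection on the domain of \<open>K\<close> acts as the same block
    projection on its range.\<close>
  have "K ** ?P c = ?P c ** K" for c
    using block_diagonal_op_powr[OF pos cl, of "1/2"] by (simp add: K_def block_diagonal_iff_commute)
  then have comm: "K *v (?P c *v y) = ?P c *v (K *v y)" for c y
    by (simp add: matrix_vector_mul_assoc)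
  show ?thesis
  proof (cases "\<forall>y a. slice a (K *v y) \<in> supp \<sigma>")
    case True
    then have True': "\<forall>y a. slice a (K *v y) \<in> supp ?\<sigma>'" using supp_pinch[OF \<sigma>] by blast
    have le: "Re (cinner x (cond_gram K ?\<sigma>' s *v x)) \<le>
        (\<Sum>c\<in>UNIV. Re (cinner (?P c *v x) (cond_gram K \<sigma> s *v (?P c *v x))))" for x
    proof -
      \<comment> \<open>The exponent is minus a number strictly between 0 and 1, as the resolvent
        representation requires.\<close>
      have s: "s = - (1 - 1 / \<alpha>)" using \<alpha> by (simp add: s_def field_simps)
      have "block_proj f c *v slice a (K *v x) \<in> supp \<sigma>" for a c
        using True by (metis slice_block_proj comm)
      then have "Re (cinner (slice a (K *v x)) (op_powr ?\<sigma>' s *v slice a (K *v x))) \<le>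
          (\<Sum>c\<in>UNIV. Re (cinner (block_proj f c *v slice a (K *v x))
            (op_powr \<sigma> s *v (block_proj f c *v slice a (K *v x)))))" for a
        unfolding s using \<alpha> by (intro op_powr_pinch_le[OF \<sigma>]) auto
      then have "Re (cinner x (cond_gram K ?\<sigma>' s *v x)) \<le>
          (\<Sum>a\<in>UNIV. \<Sum>c\<in>UNIV. Re (cinner (slice a (K *v (?P c *v x)))
            (op_powr \<sigma> s *v slice a (K *v (?P c *v x)))))"
        unfolding cinner_cond_gram comm slice_block_proj Re_sum by (rule sum_mono)
      also have "\<dots> = (\<Sum>c\<in>UNIV. Re (cinner (?P c *v x) (cond_gram K \<sigma> s *v (?P c *v x))))"
        unfolding cinner_cond_gram Re_sum by (rule sum.swap)
      finally show ?thesis .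
    qed
    \<comment> \<open>Otherwise a power of the pinched \<sigma>, injective on its support, would
      annihilate every slice of every \<open>K *v y\<close>; then \<open>K\<close> and the state
      would vanish, contradicting trace 1.\<close>
    have "cond_gram K ?\<sigma>' s \<noteq> 0"
    proof
      assume 0: "cond_gram K ?\<sigma>' s = 0"
      define Y where "Y = tensor_op (mat 1 :: 'a operator) (op_powr ?\<sigma>' (s / 2)) ** K"
      have "K *v y = 0" for y
      proof (rule eq_zero_of_slices)
        fix a
        have "cinner (Y *v y) (Y *v y) = cinner y (cond_gram K ?\<sigma>' s *v y)"
          by (simp add: cond_gram_eq[OF \<sigma>'] Y_def cinner_adjoint_op_left matrix_vector_mul_assoc)
        then have "Y *v y = 0" by (simp add: 0)
        then have "op_powr ?\<sigma>' (s / 2) *v slice a (K *v y) = 0"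
          by (metis Y_def matrix_vector_mul_assoc slice_tensor_one slice_zero)
        then show "slice a (K *v y) = 0"
          using True' op_powr_supp_eq_zero[OF \<sigma>'] by blast
      qed
      then have "\<rho> *v y = 0" for y by (simp add: \<rho>K flip: matrix_vector_mul_assoc)
      then have "\<rho> = 0" by (simp add: matrix_eq)
      then show False using tr by (simp add: trace_def)
    qed
    then have "0 < Re (trace (op_powr (cond_gram K ?\<sigma>' s) \<alpha>))"
      by (rule trace_op_powr_pos[OF positive_op_cond_gram[OF \<sigma>']])
    moreover have "Re (trace (op_powr (cond_gram K ?\<sigma>' s) \<alpha>)) \<le> Re (trace (op_powr (cond_gram K \<sigma> s) \<alpha>))"
      by (rule trace_op_powr_le_pinch[OF positive_op_cond_gram[OF \<sigma>] positive_op_cond_gram[OF \<sigma>'] \<alpha> le])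
    ultimately have "log 2 (Re (trace (op_powr (cond_gram K ?\<sigma>' s) \<alpha>))) \<le>
        log 2 (Re (trace (op_powr (cond_gram K \<sigma> s) \<alpha>)))"
      by simp
    \<comment> \<open>The negative prefactor reverses the inequality.\<close>
    then have "1 / (1 - \<alpha>) * log 2 (Re (trace (op_powr (cond_gram K \<sigma> s) \<alpha>))) \<le>
        1 / (1 - \<alpha>) * log 2 (Re (trace (op_powr (cond_gram K ?\<sigma>' s) \<alpha>)))"
      using \<alpha> by (intro mult_left_mono_neg) auto
    then show ?thesis
      unfolding \<rho>K renyi_rel_gram[OF \<sigma>] renyi_rel_gram[OF \<sigma>']
      using True True' by (simp add: s_def)
  next
    case False
    then have "renyi_rel \<alpha> \<rho> \<sigma> = - \<infinity>"
      unfolding \<rho>K renyi_rel_gram[OF \<sigma>] by (simp only: if_False)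
    then show ?thesis by simp
  qed
qed

lemma renyi_entropy_eq_SUP_block_diagonal:
  fixes \<rho> :: "('a::finite \<times> 'b::finite) operator" and f :: "'b \<Rightarrow> 'c::finite"
  assumes "1 < \<alpha>" "state \<rho>" "block_diagonal (\<lambda>i. f (snd i)) \<rho>"
  shows "renyi_entropy \<alpha> \<rho> = (SUP \<sigma> \<in> {\<sigma>. state \<sigma> \<and> block_diagonal f \<sigma>}. renyi_rel \<alpha> \<rho> \<sigma>)"
  unfolding renyi_entropy_def
proof (rule antisym)
  show "(SUP \<sigma> \<in> {\<sigma>. state \<sigma>}. renyi_rel \<alpha> \<rho> \<sigma>) \<le>
      (SUP \<sigma> \<in> {\<sigma>. state \<sigma> \<and> block_diagonal f \<sigma>}. renyi_rel \<alpha> \<rho> \<sigma>)"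
  proof (rule SUP_mono)
    fix \<sigma> :: "'b operator"
    assume "\<sigma> \<in> {\<sigma>. state \<sigma>}"
    then have "state \<sigma>" by simp
    moreover from this have "renyi_rel \<alpha> \<rho> \<sigma> \<le> renyi_rel \<alpha> \<rho> (pinch f \<sigma>)"
      using assms by (intro renyi_rel_le_pinch) (auto simp: state_def)
    ultimately show "\<exists>\<tau>\<in>{\<sigma>. state \<sigma> \<and> block_diagonal f \<sigma>}. renyi_rel \<alpha> \<rho> \<sigma> \<le> renyi_rel \<alpha> \<rho> \<tau>"
      using state_pinch block_diagonal_pinch by blast
  qed
qed (rule SUP_subset_mono, auto)

section \<open>Invariance under controlled isometries\<close>

text \<open>Since \<open>0 powr 0 = 0\<close>, the power 0 is the support projection. Membership
  becomes a linear equation, which can be carried through the controlled isometry.\<close>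

lemma mem_supp_iff:
  assumes A: "positive_op A"
  shows "x \<in> supp A \<longleftrightarrow> op_powr A 0 *v x = x"
proof -
  let ?P = "op_powr A 0"
  have adj: "adjoint_op A = A" using A by (simp add: positive_op_def)
  have AP: "A ** ?P = A" using op_powr_mult[OF A, of 1 0] by (simp add: op_powr_one[OF A])
  have range: "?P *v x = A *v (op_powr A (-1) *v x)" for x
    using op_powr_mult[OF A, of 1 "-1"] by (simp add: op_powr_one[OF A] matrix_vector_mul_assoc)
  have orth: "cinner y (?P *v x) = 0" if "A *v y = 0" for x y
    unfolding range cinner_adjoint_op adj by (simp add: that)
  show ?thesis
  proof
    assume x: "x \<in> supp A"
    define y where "y = x - ?P *v x"
    have y0: "A *v y = 0"
      by (simp add: y_def matrix_vector_mult_diff_distrib matrix_vector_mul_assoc AP)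
    then have "cinner y x = 0" using x by (simp add: supp_def)
    then have "cinner y y = 0"
      using orth[OF y0, of x] by (subst (2) y_def) (simp add: cinner_diff_right)
    then have "y = 0" by (simp only: cinner_eq_zero_iff)
    then show "?P *v x = x" by (simp add: y_def)
  next
    assume "?P *v x = x"
    then have "cinner y x = 0" if "A *v y = 0" for y using orth[OF that, of x] by simp
    then show "x \<in> supp A" by (simp add: supp_def)
  qed
qed

lemma slices_in_supp_iff:
  fixes x :: "complex ^ ('a::finite \<times> 'b::finite)"
  assumes "positive_op A"
  shows "(\<forall>a. slice a x \<in> supp A) \<longleftrightarrow> tensor_op (mat 1) (op_powr A 0) *v x = x"
proof -
  have "y = x \<longleftrightarrow> (\<forall>a. slice a y = slice a x)" for y
    by (simp add: vec_eq_iff)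
  then show ?thesis by (simp only: mem_supp_iff[OF assms] slice_tensor_one)
qed

text \<open>Polarization inside \<open>S\<close>: the norm of \<open>x + z\<close> gives the real
  part, and replacing \<open>y\<close> by \<open>\<i> *s y\<close>, which remains in the complex
  subspace, gives the imaginary part.\<close>

lemma isometry_on_cinner:
  fixes V :: "complex ^ 'a::finite ^ 'b::finite"
  assumes V: "isometry_on S V" and S: "vec.subspace S" and x: "x \<in> S" and y: "y \<in> S"
  shows "cinner (V *v x) (V *v y) = cinner x y"
proof -
  have Re: "Re (cinner (V *v x) (V *v z)) = Re (cinner x z)" if z: "z \<in> S" for z
  proof -
    have "norm (V *v (x + z)) = norm (x + z)"
      using V vec.subspace_add[OF S x z] by (simp add: isometry_on_def)
    then have "inner (V *v x + V *v z) (V *v x + V *v z) = inner (x + z) (x + z)"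
      by (simp add: norm_eq matrix_vector_right_distrib)
    moreover have "inner (V *v w) (V *v w) = inner w w" if "w \<in> S" for w
      using V that by (simp add: isometry_on_def norm_eq)
    ultimately show ?thesis
      using x z by (simp add: Re_cinner inner_add_left inner_add_right inner_commute)
  qed
  have "Re (cinner (V *v x) (V *v (\<i> *s y))) = Re (cinner x (\<i> *s y))"
    by (rule Re[OF vec.subspace_scale[OF S y]])
  then have "Im (cinner (V *v x) (V *v y)) = Im (cinner x y)"
    by (simp add: vec.scale cinner_scale_right)
  then show ?thesis using Re[OF y] by (simp add: complex_eq_iff)
qed

text \<open>Complementary to \<open>slice\<close>: the labels of the classical and the third
  register are fixed and a vector on the first register remains, on which the controlled operator
  acts as \<open>V c\<close>.\<close>

definition fiber :: "'c::finite \<Rightarrow> 'e::finite \<Rightarrow> complex ^ ('a::finite \<times> 'c \<times> 'e) \<Rightarrow> complex ^ 'a" where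
  "fiber c e x = (\<chi> a. x $ (a, c, e))"

lemma fiber_nth [simp]: "fiber c e x $ a = x $ (a, c, e)"
  by (simp add: fiber_def)

lemma eq_of_fibers: "(\<And>c e. fiber c e x = fiber c e y) \<Longrightarrow> x = y"
  by (simp add: vec_eq_iff)

lemma cinner_fibers: "cinner x y = (\<Sum>c\<in>UNIV. \<Sum>e\<in>UNIV. cinner (fiber c e x) (fiber c e y))"
proof -
  have "cinner x y = (\<Sum>a\<in>UNIV. \<Sum>c\<in>UNIV. \<Sum>e\<in>UNIV. cnj (x $ (a, c, e)) * y $ (a, c, e))"
    by (simp add: cinner_def sum_prod_UNIV)
  also have "\<dots> = (\<Sum>c\<in>UNIV. \<Sum>a\<in>UNIV. \<Sum>e\<in>UNIV. cnj (x $ (a, c, e)) * y $ (a, c, e))"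
    by (rule sum.swap)
  also have "\<dots> = (\<Sum>c\<in>UNIV. \<Sum>e\<in>UNIV. \<Sum>a\<in>UNIV. cnj (x $ (a, c, e)) * y $ (a, c, e))"
    by (intro sum.cong refl sum.swap)
  finally show ?thesis by (simp add: cinner_def)
qed

lemma fiber_controlled_op:
  fixes V :: "'c::finite \<Rightarrow> complex ^ 'a::finite ^ 'b::finite" and x :: "complex ^ ('a \<times> 'c \<times> 'e::finite)"
  shows "fiber c e (controlled_op V *v x) = V c *v fiber c e x"
proof -
  have entry: "controlled_op V $ (b, c, e) $ (a, c', e') = (if c' = c \<and> e' = e then V c $ b $ a else 0)"
    for a b c' e'
  proof -
    have "controlled_op V $ (b, c, e) $ (a, c', e') =
        (\<Sum>k\<in>UNIV. if k = c then (if c' = c \<and> e' = e then V c $ b $ a else 0) else 0)"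
      unfolding controlled_op_def sum_component
      by (intro sum.cong refl) (auto simp: tensor_op_def basis_proj_def mat_def)
    then show ?thesis by simp
  qed
  have "(controlled_op V *v x) $ (b, c, e) = (\<Sum>a\<in>UNIV. V c $ b $ a * x $ (a, c, e))" for b
  proof -
    have "(controlled_op V *v x) $ (b, c, e) =
        (\<Sum>a\<in>UNIV. \<Sum>c'\<in>UNIV. \<Sum>e'\<in>UNIV. controlled_op V $ (b, c, e) $ (a, c', e') * x $ (a, c', e'))"
      by (simp add: matrix_vector_mult_def sum_prod_UNIV)
    also have "\<dots> = (\<Sum>a\<in>UNIV. \<Sum>c'\<in>UNIV. if c' = c then \<Sum>e'\<in>UNIV. if e' = e then V c $ b $ a * x $ (a, c, e) else 0 else 0)"
      unfolding entry
      by (intro sum.cong refl) (auto simp: if_distrib[of "\<lambda>z. z * _"] cong: if_cong)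
    finally show ?thesis by simp
  qed
  then show ?thesis by (simp add: vec_eq_iff matrix_vector_mult_def)
qed

text \<open>Block diagonality confines the mixing to fibers with the same \<open>c\<close>, so
  linearity of a single \<open>V c\<close>, or closure of a single \<open>S c\<close>, applies to
  the result.\<close>

lemma fiber_tensor_one:
  fixes T :: "('c::finite \<times> 'e::finite) operator" and x :: "complex ^ ('a::finite \<times> 'c \<times> 'e)"
  assumes T: "block_diagonal fst T"
  shows "fiber c e (tensor_op (mat 1) T *v x) = (\<Sum>e'\<in>UNIV. T $ (c, e) $ (c, e') *s fiber c e' x)"
proof -
  have "(tensor_op (mat 1) T *v x) $ (a, c, e) = (\<Sum>e'\<in>UNIV. T $ (c, e) $ (c, e') * x $ (a, c, e'))" for a
  proof -
    have "(tensor_op (mat 1) T *v x) $ (a, c, e) = slice a (tensor_op (mat 1) T *v x) $ (c, e)" by simp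
    also have "\<dots> = (\<Sum>c'\<in>UNIV. \<Sum>e'\<in>UNIV. T $ (c, e) $ (c', e') * x $ (a, c', e'))"
      unfolding slice_tensor_one by (simp add: matrix_vector_mult_def sum_prod_UNIV)
    also have "\<dots> = (\<Sum>c'\<in>UNIV. if c' = c then \<Sum>e'\<in>UNIV. T $ (c, e) $ (c, e') * x $ (a, c, e') else 0)"
    proof (intro sum.cong refl)
      fix c'
      have "T $ (c, e) $ (c', e') = 0" if "c' \<noteq> c" for e'
        using T that by (simp add: block_diagonal_def)
      then show "(\<Sum>e'\<in>UNIV. T $ (c, e) $ (c', e') * x $ (a, c', e')) =
          (if c' = c then \<Sum>e'\<in>UNIV. T $ (c, e) $ (c, e') * x $ (a, c, e') else 0)"
        by simp
    qed
    finally show ?thesis by simp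
  qed
  then show ?thesis by (simp add: vec_eq_iff)
qed

lemma controlled_op_tensor_one_commute:
  fixes V :: "'c::finite \<Rightarrow> complex ^ 'a::finite ^ 'b::finite" and T :: "('c \<times> 'e::finite) operator"
  assumes T: "block_diagonal fst T"
  shows "tensor_op (mat 1) T *v (controlled_op V *v x) = controlled_op V *v (tensor_op (mat 1) T *v x)"
  by (rule eq_of_fibers)
    (simp add: fiber_tensor_one[OF T] fiber_controlled_op vec.sum vec.scale)

text \<open>The natural domain of the controlled isometry: the direct sum over \<open>c\<close> of
  \<open>S c\<close> tensored with the basis vector \<open>c\<close> and the whole third
  register.\<close>

definition fibers_in :: "('c::finite \<Rightarrow> (complex ^ 'a::finite) set) \<Rightarrow> (complex ^ ('a \<times> 'c \<times> 'e::finite)) set" where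
  "fibers_in S = {x. \<forall>c e. fiber c e x \<in> S c}"

lemma fibers_in_subspace:
  fixes S :: "'c::finite \<Rightarrow> (complex ^ 'a::finite) set"
  assumes "\<And>c. vec.subspace (S c)"
  shows "vec.subspace (fibers_in S :: (complex ^ ('a \<times> 'c \<times> 'e::finite)) set)"
proof -
  have "fiber c e (x + y) = fiber c e x + fiber c e y" "fiber c e (k *s x) = k *s fiber c e x"
    "fiber c e (0 :: complex ^ ('a \<times> 'c \<times> 'e)) = 0" for c e k and x y :: "complex ^ ('a \<times> 'c \<times> 'e)"
    by (simp_all add: vec_eq_iff)
  then show ?thesis using assms by (simp add: fibers_in_def vec.subspace_def)
qed

lemma isometry_on_controlled_op:
  fixes V :: "'c::finite \<Rightarrow> complex ^ 'a::finite ^ 'b::finite"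
  assumes "\<And>c. isometry_on (S c) (V c)"
  shows "isometry_on (fibers_in S) (controlled_op V :: complex ^ ('a \<times> 'c \<times> 'e::finite) ^ ('b \<times> 'c \<times> 'e))"
  unfolding isometry_on_def
proof
  fix x :: "complex ^ ('a \<times> 'c \<times> 'e)"
  assume x: "x \<in> fibers_in S"
  have "cinner (V c *v fiber c e x) (V c *v fiber c e x) = cinner (fiber c e x) (fiber c e x)" for c e
    using assms[of c] x by (simp add: cinner_self isometry_on_def fibers_in_def)
  then have "cinner (controlled_op V *v x) (controlled_op V *v x) = cinner x x"
    by (simp only: cinner_fibers[of "controlled_op V *v x"] cinner_fibers[of x x] fiber_controlled_op)
  then have "(norm (controlled_op V *v x))\<^sup>2 = (norm x)\<^sup>2"
    unfolding cinner_self of_real_eq_iff .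
  then show "norm (controlled_op V *v x) = norm x" by simp
qed

lemma tensor_one_fibers_in:
  assumes "\<And>c. vec.subspace (S c)" "block_diagonal fst T" "x \<in> fibers_in S"
  shows "tensor_op (mat 1) T *v x \<in> fibers_in S"
  using assms
  by (simp add: fibers_in_def fiber_tensor_one[OF assms(2)] vec.subspace_sum vec.subspace_scale)

text \<open>This converts the hypothesis on conditional supports into one on the range of
  \<open>K\<close>. The quadratic form of the conditional state at \<open>v\<close> is, up to
  normalization, a sum over \<open>e\<close> of squared norms of \<open>adjoint_op K\<close> applied
  to \<open>v\<close> placed at \<open>(c, e)\<close>; if it vanishes, every fiber of
  \<open>K *v y\<close> at \<open>c\<close> is orthogonal to \<open>v\<close>.\<close>

lemma fiber_mem_supp_cond_state:
  fixes K :: "complex ^ 'k::finite ^ ('a::finite \<times> 'c::finite \<times> 'e::finite)"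
  shows "fiber c e (K *v y) \<in> supp (cond_state (K ** adjoint_op K) c)"
proof -
  let ?\<rho> = "K ** adjoint_op K"
  define p where "p = (\<Sum>b\<in>UNIV. \<Sum>e\<in>UNIV. ?\<rho> $ (b, c, e) $ (b, c, e))"
  have "cinner v (fiber c e (K *v y)) = 0" if v: "cond_state ?\<rho> c *v v = 0" for v
  proof (cases "p = 0")
    case True
    \<comment> \<open>For an outcome of probability 0 the conditional state is zero, so the fiber
      itself must vanish. It does, because the diagonal entries of the state are squared row norms
      of \<open>K\<close>.\<close>
    have diag: "?\<rho> $ i $ i = complex_of_real (\<Sum>k\<in>UNIV. (cmod (K $ i $ k))\<^sup>2)" for i
      by (simp add: matrix_matrix_mult_def adjoint_op_def complex_norm_square del: of_real_power)
    have "complex_of_real (\<Sum>b\<in>UNIV. \<Sum>e\<in>UNIV. \<Sum>k\<in>UNIV. (cmod (K $ (b, c, e) $ k))\<^sup>2) = 0"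
      using True unfolding p_def diag by simp
    then have "(\<Sum>b\<in>UNIV. \<Sum>e\<in>UNIV. \<Sum>k\<in>UNIV. (cmod (K $ (b, c, e) $ k))\<^sup>2) = 0"
      by (simp only: of_real_eq_0_iff)
    then have "K $ (b, c, e) $ k = 0" for b k
      by (simp add: sum_nonneg_eq_0_iff sum_nonneg)
    then have "fiber c e (K *v y) = 0" by (simp add: vec_eq_iff matrix_vector_mult_def)
    then show ?thesis by simp
  next
    case False
    define w :: "'e \<Rightarrow> complex ^ ('a \<times> 'c \<times> 'e)" where "w e = tensor_vec v (axis (c, e) 1)" for e
    have fw: "fiber c' e' (w e) = (if c' = c \<and> e' = e then v else 0)" for c' e' e
      by (simp add: vec_eq_iff w_def tensor_vec_def axis_def)
    have w: "cinner (w e) x = cinner v (fiber c e x)" for e x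
    proof -
      have "cinner (w e) x = (\<Sum>c'\<in>UNIV. if c' = c then \<Sum>e'\<in>UNIV. if e' = e then cinner v (fiber c e x) else 0 else 0)"
        unfolding cinner_fibers[of "w e"] fw
        by (intro sum.cong refl) (auto simp: if_distrib[of "\<lambda>z. cinner z _"] cong: if_cong)
      then show ?thesis by simp
    qed
    have \<rho>w: "(?\<rho> *v w e) $ (a, c, e) = (\<Sum>a'\<in>UNIV. ?\<rho> $ (a, c, e) $ (a', c, e) * v $ a')" for a e
    proof -
      have "(?\<rho> *v w e) $ (a, c, e) = (\<Sum>a'\<in>UNIV. \<Sum>c'\<in>UNIV. \<Sum>e'\<in>UNIV. ?\<rho> $ (a, c, e) $ (a', c', e') * w e $ (a', c', e'))"
        by (simp add: matrix_vector_mult_def[of ?\<rho>] sum_prod_UNIV)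
      also have "\<dots> = (\<Sum>a'\<in>UNIV. \<Sum>c'\<in>UNIV. if c' = c then \<Sum>e'\<in>UNIV. if e' = e then ?\<rho> $ (a, c, e) $ (a', c, e) * v $ a' else 0 else 0)"
        by (intro sum.cong refl)
          (auto simp: w_def tensor_vec_def axis_def if_distrib[of "\<lambda>z. _ * z"] cong: if_cong)
      finally show ?thesis by simp
    qed
    have "p *s (cond_state ?\<rho> c *v v) = (\<Sum>e\<in>UNIV. fiber c e (?\<rho> *v w e))"
    proof -
      have "(p *s (cond_state ?\<rho> c *v v)) $ a = (\<Sum>e\<in>UNIV. fiber c e (?\<rho> *v w e)) $ a" for a
      proof -
        have entry: "p * cond_state ?\<rho> c $ a $ a' = (\<Sum>e\<in>UNIV. ?\<rho> $ (a, c, e) $ (a', c, e))" for a'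
          using False by (simp add: cond_state_def flip: p_def)
        have "(p *s (cond_state ?\<rho> c *v v)) $ a = (\<Sum>a'\<in>UNIV. p * cond_state ?\<rho> c $ a $ a' * v $ a')"
          by (simp add: matrix_vector_mult_def[of "cond_state _ _"] sum_distrib_left mult.assoc)
        also have "\<dots> = (\<Sum>a'\<in>UNIV. \<Sum>e\<in>UNIV. ?\<rho> $ (a, c, e) $ (a', c, e) * v $ a')"
          unfolding entry sum_distrib_right ..
        also have "\<dots> = (\<Sum>e\<in>UNIV. fiber c e (?\<rho> *v w e)) $ a"
          by (subst sum.swap) (simp add: \<rho>w)
        finally show ?thesis .
      qed
      then show ?thesis by (simp add: vec_eq_iff)
    qed
    then have "(\<Sum>e\<in>UNIV. cinner v (fiber c e (?\<rho> *v w e))) = 0"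
      using v by (simp flip: cinner_sum_right)
    moreover have "cinner v (fiber c e (?\<rho> *v w e)) = complex_of_real ((norm (adjoint_op K *v w e))\<^sup>2)" for e
      unfolding w[symmetric] cinner_self[symmetric]
      by (simp add: cinner_adjoint_op_left[of "adjoint_op K"] matrix_vector_mul_assoc)
    ultimately have "complex_of_real (\<Sum>e\<in>UNIV. (norm (adjoint_op K *v w e))\<^sup>2) = 0" by simp
    then have "(\<Sum>e\<in>UNIV. (norm (adjoint_op K *v w e))\<^sup>2) = 0" by (simp only: of_real_eq_0_iff)
    then have "adjoint_op K *v w e = 0" by (simp add: sum_nonneg_eq_0_iff)
    then show ?thesis by (simp add: cinner_adjoint_op flip: w)
  qed
  then show ?thesis by (simp add: supp_def)
qed

lemma renyi_rel_controlled_isometry: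
  fixes V :: "'c::finite \<Rightarrow> complex ^ 'a::finite ^ 'b::finite" and \<sigma> :: "('c \<times> 'e::finite) operator"
    and K :: "complex ^ 'k::finite ^ ('a \<times> 'c \<times> 'e)"
  assumes S: "\<And>c. vec.subspace (S c)" and V: "\<And>c. isometry_on (S c) (V c)"
    and K: "\<And>y. K *v y \<in> fibers_in S"
    and \<sigma>: "positive_op \<sigma>" "block_diagonal fst \<sigma>"
  defines "L \<equiv> controlled_op V ** K"
  shows "renyi_rel \<alpha> (L ** adjoint_op L) \<sigma> = renyi_rel \<alpha> (K ** adjoint_op K) \<sigma>"
proof -
  let ?V = "controlled_op V :: complex ^ ('a \<times> 'c \<times> 'e) ^ ('b \<times> 'c \<times> 'e)"
  define T where "T = op_powr \<sigma>"
  have T: "block_diagonal fst (T s)" for s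
    unfolding T_def by (rule block_diagonal_op_powr[OF \<sigma>])
  have iso: "cinner (?V *v x) (?V *v y) = cinner x y" if "x \<in> fibers_in S" "y \<in> fibers_in S" for x y
    by (rule isometry_on_cinner[OF isometry_on_controlled_op[OF V] fibers_in_subspace[OF S] that])
  have TK: "tensor_op (mat 1) (T s) *v (K *v y) \<in> fibers_in S" for s y
    by (rule tensor_one_fibers_in[OF S T K])
  have TL: "tensor_op (mat 1) (T s) *v (L *v y) = ?V *v (tensor_op (mat 1) (T s) *v (K *v y))" for s y
    by (simp add: L_def controlled_op_tensor_one_commute[OF T] flip: matrix_vector_mul_assoc)
  have "cond_gram L \<sigma> s = cond_gram K \<sigma> s" for s
  proof -
    have "cinner x (cond_gram L \<sigma> s *v y) = cinner x (cond_gram K \<sigma> s *v y)" for x y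
    proof -
      \<comment> \<open>After halving the exponent, both arguments are images under
        \<open>?V\<close> of vectors in \<open>fibers_in S\<close>, so \<open>?V\<close> can be
        cancelled.\<close>
      have "cinner x (cond_gram L \<sigma> s *v y) = cinner (tensor_op (mat 1) (T (s / 2)) *v (L *v x))
          (tensor_op (mat 1) (T (s / 2)) *v (L *v y))"
        by (simp add: cond_gram_eq[OF \<sigma>(1)] T_def cinner_adjoint_op_left matrix_vector_mul_assoc
            adjoint_op_mult matrix_mul_assoc)
      also have "\<dots> = cinner (tensor_op (mat 1) (T (s / 2)) *v (K *v x))
          (tensor_op (mat 1) (T (s / 2)) *v (K *v y))"
        unfolding TL by (rule iso[OF TK TK])
      also have "\<dots> = cinner x (cond_gram K \<sigma> s *v y)"
        by (simp add: cond_gram_eq[OF \<sigma>(1)] T_def cinner_adjoint_op_left matrix_vector_mul_assoc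
            adjoint_op_mult matrix_mul_assoc)
      finally show ?thesis .
    qed
    then have "cinner (cond_gram L \<sigma> s *v y - cond_gram K \<sigma> s *v y)
        (cond_gram L \<sigma> s *v y - cond_gram K \<sigma> s *v y) = 0" for y
      by (simp only: cinner_diff_right) simp
    then show ?thesis by (simp add: matrix_eq)
  qed
  moreover have "(\<forall>y b. slice b (L *v y) \<in> supp \<sigma>) \<longleftrightarrow> (\<forall>y a. slice a (K *v y) \<in> supp \<sigma>)"
  proof -
    have "tensor_op (mat 1) (T 0) *v (L *v y) = L *v y \<longleftrightarrow> tensor_op (mat 1) (T 0) *v (K *v y) = K *v y" for y
    proof -
      \<comment> \<open>The defect of \<open>K *v y\<close> from lying in the full tensor product
        with the support of \<sigma>. It belongs to \<open>fibers_in S\<close>, where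
        \<open>?V\<close> is injective, so both support conditions hold or fail together.\<close>
      let ?d = "tensor_op (mat 1) (T 0) *v (K *v y) - K *v y"
      have "?d \<in> fibers_in S" by (rule vec.subspace_diff[OF fibers_in_subspace[OF S] TK K])
      then have "cinner (?V *v ?d) (?V *v ?d) = cinner ?d ?d" by (intro iso)
      then have "?V *v ?d = 0 \<longleftrightarrow> ?d = 0" by (metis cinner_eq_zero_iff)
      moreover have "?V *v ?d = tensor_op (mat 1) (T 0) *v (L *v y) - L *v y"
        unfolding TL by (simp add: matrix_vector_mult_diff_distrib L_def matrix_vector_mul_assoc)
      ultimately show ?thesis by simp
    qed
    then show ?thesis by (simp only: slices_in_supp_iff[OF \<sigma>(1)] T_def )
  qed
  ultimately show ?thesis
    unfolding renyi_rel_gram[OF \<sigma>(1)] by (simp only:)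
qed

theorem lemma5:
  fixes \<alpha> :: real
    and \<rho>R :: "('r :: finite \<times> 'c :: finite \<times> 'e :: finite) operator"
    and \<rho>Z :: "('n :: len0 bits_upto \<times> 'c \<times> 'e) operator"
    and Rsub :: "'c \<Rightarrow> (complex ^ 'r) set"
    and V :: "'c \<Rightarrow> complex ^ 'r ^ 'n bits_upto"
  assumes "\<alpha> > 1"
    and "state \<rho>R" and "classical_mid \<rho>R"
    and "state \<rho>Z" and "classical_mid \<rho>Z"
    and "\<And>c. vec.subspace (Rsub c)"
    and "\<And>c. supp (cond_state \<rho>R c) \<subseteq> Rsub c"
    and "\<And>c. isometry_on (Rsub c) (V c)"
    and "controlled_op V ** \<rho>R ** adjoint_op (controlled_op V) = \<rho>Z"
  shows "renyi_entropy \<alpha> \<rho>Z = renyi_entropy \<alpha> \<rho>R"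
proof -
  define K where "K = op_powr \<rho>R (1/2)"
  \<comment> \<open>A factor of \<open>\<rho>Z\<close> with the same domain as \<open>K\<close>; it
    is rectangular in general, not the square root of \<open>\<rho>Z\<close>.\<close>
  define L where "L = controlled_op V ** K"
  have \<rho>R: "\<rho>R = K ** adjoint_op K"
    using assms(2) unfolding state_def K_def by (simp only: sqrt_gram)
  have \<rho>Z: "\<rho>Z = L ** adjoint_op L"
    unfolding assms(9)[symmetric] L_def \<rho>R by (simp only: adjoint_op_mult matrix_mul_assoc)
  have "K *v y \<in> fibers_in Rsub" for y
    using fiber_mem_supp_cond_state[of _ _ K y] assms(7) unfolding \<rho>R fibers_in_def by blast
  then have "renyi_rel \<alpha> \<rho>Z \<sigma> = renyi_rel \<alpha> \<rho>R \<sigma>" if "state \<sigma>" "block_diagonal fst \<sigma>" for \<sigma>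
    unfolding \<rho>Z \<rho>R L_def using assms(6,8) that
    by (intro renyi_rel_controlled_isometry[where S = Rsub]) (auto simp: state_def)
  moreover have "block_diagonal (\<lambda>i. fst (snd i)) \<rho>R" "block_diagonal (\<lambda>i. fst (snd i)) \<rho>Z"
    using assms(3,5) by (auto simp: block_diagonal_def classical_mid_def)
  ultimately show ?thesis
    using assms(1,2,4) by (simp add: renyi_entropy_eq_SUP_block_diagonal[of _ _ fst])
qed

end
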